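(* Let $\alpha,\alpha'\in\mathbb{C}$, let $r,r'\ge 1$ be integers, and let $M$, $M'$ be simple modules over the Lie algebras $\mathfrak{a}_r$, $\mathfrak{a}_{r'}$ respectively, such that the action of $\bar d_r$ on $M$ is injective and the action of $\bar d_{r'}$ on $M'$ is injective. Then the Virasoro modules $\mathcal{N}(M,\alpha)$ and $\mathcal{N}(M',\alpha')$ are isomorphic if and only if $\alpha-\alpha'\in\mathbb{Z}$, $r=r'$, and $M\cong M'$ as $\mathfrak{a}_r$-modules.
   Context: The Virasoro algebra $\mathfrak{V}$ is the complex Lie algebra with basis $\{c,d_i: i\in\mathbb{Z}\}$ and bracket $[d_i,d_j]=(j-i)d_{i+j}+\delta_{i,-j}\frac{i^3-i}{12}c$, $[d_i,c]=0$ for $i,j\in\mathbb{Z}$. Let $\mathfrak{V}_+$ be the Lie subalgebra of $\mathfrak{V}$ spanned by all $d_i$ with $i\geq 0$. For an integer $r\ge 0$ let $\mathfrak{V}_+^{(r)}$ be the Lie subalgebra generated by all $d_i$ with $i>r$ (it is an ideal of $\mathfrak{V}_+$), let $\mathfrak{a}_r=\mathfrak{V}_+/\mathfrak{V}_+^{(r)}$, and let $\bar d_i$ be the image of $d_i$ in $\mathfrak{a}_r$. For an $\mathfrak{a}_r$-module $M$ and $\alpha\in\mathbb{C}$, $\mathcal{N}(M,\alpha)$ is the $\mathfrak{V}$-module with underlying vector space $M\otimes\mathbb{C}[t,t^{-1}]$ and action $$d_m (v\otimes t^n)=\Big(\Big(\alpha+n+\sum_{i=0}^r\frac{m^{i+1}}{(i+1)!}\bar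 d_i\Big)v\Big)\otimes t^{n+m},\qquad c(v\otimes t^n)=0\qquad (m,n\in\mathbb{Z},\ v\in M).$$ *)

theory Defs
  imports Complex_Main "HOL-Library.Poly_Mapping"
begin

section \<open>Complex Lie algebras with an explicit carrier\<close>

text \<open>Quotients by a varying ideal have no type of their own, so Lie algebras are records with a
  carrier set; modules over them, on the other hand, live on whole types and use the library
  locale \<^locale>\<open>vector_space\<close> with an explicit scalar multiplication.\<close>

record 'a lie_structure =
  lie_carrier :: "'a set"
  lie_add :: "'a \<Rightarrow> 'a \<Rightarrow> 'a"
  lie_zero :: "'a"
  lie_scale :: "complex \<Rightarrow> 'a \<Rightarrow> 'a"
  lie_bracket :: "'a \<Rightarrow> 'a \<Rightarrow> 'a"

locale lie_algebra =
  fixes L :: "'a lie_structure"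
  assumes add_closed: "\<lbrakk>x \<in> lie_carrier L; y \<in> lie_carrier L\<rbrakk> \<Longrightarrow> lie_add L x y \<in> lie_carrier L"
    and zero_closed: "lie_zero L \<in> lie_carrier L"
    and scale_closed: "x \<in> lie_carrier L \<Longrightarrow> lie_scale L a x \<in> lie_carrier L"
    and bracket_closed:
      "\<lbrakk>x \<in> lie_carrier L; y \<in> lie_carrier L\<rbrakk> \<Longrightarrow> lie_bracket L x y \<in> lie_carrier L"
    and add_assoc: "\<lbrakk>x \<in> lie_carrier L; y \<in> lie_carrier L; z \<in> lie_carrier L\<rbrakk> \<Longrightarrow>
      lie_add L (lie_add L x y) z = lie_add L x (lie_add L y z)"
    and add_commute:
      "\<lbrakk>x \<in> lie_carrier L; y \<in> lie_carrier L\<rbrakk> \<Longrightarrow> lie_add L x y = lie_add L y x"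
    and add_zero: "x \<in> lie_carrier L \<Longrightarrow> lie_add L (lie_zero L) x = x"
    and add_inverse: "x \<in> lie_carrier L \<Longrightarrow> \<exists>y\<in>lie_carrier L. lie_add L x y = lie_zero L"
    and scale_add: "\<lbrakk>x \<in> lie_carrier L; y \<in> lie_carrier L\<rbrakk> \<Longrightarrow>
      lie_scale L a (lie_add L x y) = lie_add L (lie_scale L a x) (lie_scale L a y)"
    and add_scale: "x \<in> lie_carrier L \<Longrightarrow>
      lie_scale L (a + b) x = lie_add L (lie_scale L a x) (lie_scale L b x)"
    and scale_scale: "x \<in> lie_carrier L \<Longrightarrow> lie_scale L a (lie_scale L b x) = lie_scale L (a * b) x"
    and scale_one: "x \<in> lie_carrier L \<Longrightarrow> lie_scale L 1 x = x"
    and bracket_add_left: "\<lbrakk>x \<in> lie_carrier L; y \<in> lie_carrier L; z \<in> lie_carrier L\<rbrakk> \<Longrightarrow>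
      lie_bracket L (lie_add L x y) z = lie_add L (lie_bracket L x z) (lie_bracket L y z)"
    and bracket_add_right: "\<lbrakk>x \<in> lie_carrier L; y \<in> lie_carrier L; z \<in> lie_carrier L\<rbrakk> \<Longrightarrow>
      lie_bracket L z (lie_add L x y) = lie_add L (lie_bracket L z x) (lie_bracket L z y)"
    and bracket_scale_left: "\<lbrakk>x \<in> lie_carrier L; y \<in> lie_carrier L\<rbrakk> \<Longrightarrow>
      lie_bracket L (lie_scale L a x) y = lie_scale L a (lie_bracket L x y)"
    and bracket_scale_right: "\<lbrakk>x \<in> lie_carrier L; y \<in> lie_carrier L\<rbrakk> \<Longrightarrow>
      lie_bracket L x (lie_scale L a y) = lie_scale L a (lie_bracket L x y)"
    and bracket_self: "x \<in> lie_carrier L \<Longrightarrow> lie_bracket L x x = lie_zero L"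
    and jacobi: "\<lbrakk>x \<in> lie_carrier L; y \<in> lie_carrier L; z \<in> lie_carrier L\<rbrakk> \<Longrightarrow>
      lie_add L (lie_bracket L x (lie_bracket L y z))
        (lie_add L (lie_bracket L y (lie_bracket L z x)) (lie_bracket L z (lie_bracket L x y)))
      = lie_zero L"

definition lie_subspace :: "'a lie_structure \<Rightarrow> 'a set \<Rightarrow> bool" where
  "lie_subspace L S \<longleftrightarrow> S \<subseteq> lie_carrier L \<and> lie_zero L \<in> S \<and>
     (\<forall>x\<in>S. \<forall>y\<in>S. lie_add L x y \<in> S) \<and> (\<forall>a. \<forall>x\<in>S. lie_scale L a x \<in> S)"

definition lie_subalgebra :: "'a lie_structure \<Rightarrow> 'a set \<Rightarrow> bool" where
  "lie_subalgebra L S \<longleftrightarrow> lie_subspace L S \<and> (\<forall>x\<in>S. \<forall>y\<in>S. lie_bracket L x y \<in> S)"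

definition lie_ideal :: "'a lie_structure \<Rightarrow> 'a set \<Rightarrow> bool" where
  "lie_ideal L I \<longleftrightarrow> lie_subspace L I \<and> (\<forall>x\<in>lie_carrier L. \<forall>y\<in>I. lie_bracket L x y \<in> I)"

definition lie_generated :: "'a lie_structure \<Rightarrow> 'a set \<Rightarrow> 'a set" where
  "lie_generated L A = \<Inter>{S. lie_subalgebra L S \<and> A \<subseteq> S}"

definition lie_coset :: "'a lie_structure \<Rightarrow> 'a set \<Rightarrow> 'a \<Rightarrow> 'a set" where
  "lie_coset L I x = {lie_add L x y | y. y \<in> I}"

text \<open>The operations on cosets are written setwise, so that no representatives are chosen. In the
  scaling and the bracket the summand in the ideal \<open>I\<close> fills up the set of values to a full coset.\<close>

definition lie_quotient :: "'a lie_structure \<Rightarrow> 'a set \<Rightarrow> 'a set lie_structure" where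
  "lie_quotient L I =
    \<lparr>lie_carrier = lie_coset L I ` lie_carrier L,
     lie_add = (\<lambda>A B. {lie_add L a b | a b. a \<in> A \<and> b \<in> B}),
     lie_zero = I,
     lie_scale = (\<lambda>c A. {lie_add L (lie_scale L c a) y | a y. a \<in> A \<and> y \<in> I}),
     lie_bracket = (\<lambda>A B. {lie_add L (lie_bracket L a b) y | a b y. a \<in> A \<and> b \<in> B \<and> y \<in> I})\<rparr>"


section \<open>Modules over Lie algebras\<close>

text \<open>A module is a complex vector space, given by a type with scalar multiplication \<open>s\<close>, together
  with an action \<open>\<rho>\<close>; the values of \<open>\<rho>\<close> outside of the carrier of \<open>L\<close> are irrelevant.\<close>

locale lie_module = lie: lie_algebra L + vector_space s
  for L :: "'a lie_structure" and s :: "complex \<Rightarrow> 'v::ab_group_add \<Rightarrow> 'v" +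
  fixes \<rho> :: "'a \<Rightarrow> 'v \<Rightarrow> 'v"
  assumes act_linear: "x \<in> lie_carrier L \<Longrightarrow> Vector_Spaces.linear s s (\<rho> x)"
    and act_add: "\<lbrakk>x \<in> lie_carrier L; y \<in> lie_carrier L\<rbrakk> \<Longrightarrow> \<rho> (lie_add L x y) v = \<rho> x v + \<rho> y v"
    and act_scale: "x \<in> lie_carrier L \<Longrightarrow> \<rho> (lie_scale L a x) v = s a (\<rho> x v)"
    and act_bracket: "\<lbrakk>x \<in> lie_carrier L; y \<in> lie_carrier L\<rbrakk> \<Longrightarrow>
      \<rho> (lie_bracket L x y) v = \<rho> x (\<rho> y v) - \<rho> y (\<rho> x v)"

definition lie_submodule ::
  "'a lie_structure \<Rightarrow> (complex \<Rightarrow> 'v::ab_group_add \<Rightarrow> 'v) \<Rightarrow> ('a \<Rightarrow> 'v \<Rightarrow> 'v) \<Rightarrow> 'v set \<Rightarrow> bool" where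
  "lie_submodule L s \<rho> W \<longleftrightarrow>
     module.subspace s W \<and> (\<forall>x\<in>lie_carrier L. \<forall>w\<in>W. \<rho> x w \<in> W)"

definition simple_lie_module ::
  "'a lie_structure \<Rightarrow> (complex \<Rightarrow> 'v::ab_group_add \<Rightarrow> 'v) \<Rightarrow> ('a \<Rightarrow> 'v \<Rightarrow> 'v) \<Rightarrow> bool" where
  "simple_lie_module L s \<rho> \<longleftrightarrow> lie_module L s \<rho> \<and> (UNIV :: 'v set) \<noteq> {0} \<and>
     (\<forall>W. lie_submodule L s \<rho> W \<longrightarrow> W = {0} \<or> W = UNIV)"

definition lie_module_iso ::
  "'a lie_structure \<Rightarrow> (complex \<Rightarrow> 'v::ab_group_add \<Rightarrow> 'v) \<Rightarrow> ('a \<Rightarrow> 'v \<Rightarrow> 'v) \<Rightarrow>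
    (complex \<Rightarrow> 'w::ab_group_add \<Rightarrow> 'w) \<Rightarrow> ('a \<Rightarrow> 'w \<Rightarrow> 'w) \<Rightarrow> bool" where
  "lie_module_iso L s \<rho> s' \<rho>' \<longleftrightarrow>
     (\<exists>f. Vector_Spaces.linear s s' f \<and> bij f \<and>
        (\<forall>x\<in>lie_carrier L. \<forall>v. f (\<rho> x v) = \<rho>' x (f v)))"


section \<open>The Virasoro algebra and its subquotients\<close>

datatype vir_basis = Vir_d int | Vir_c

type_synonym vir = "vir_basis \<Rightarrow>\<^sub>0 complex"

definition pm_scale :: "(complex \<Rightarrow> 'v \<Rightarrow> 'v) \<Rightarrow> complex \<Rightarrow> ('i \<Rightarrow>\<^sub>0 'v) \<Rightarrow> ('i \<Rightarrow>\<^sub>0 'v::zero)" where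
  "pm_scale s a = Poly_Mapping.map (s a)"

definition lin_ext ::
  "(complex \<Rightarrow> 'v \<Rightarrow> 'v) \<Rightarrow> ('b \<Rightarrow> 'v) \<Rightarrow> ('b \<Rightarrow>\<^sub>0 complex) \<Rightarrow> 'v::comm_monoid_add" where
  "lin_ext s f x = (\<Sum>b\<in>Poly_Mapping.keys x. s (Poly_Mapping.lookup x b) (f b))"

abbreviation vir_scale :: "complex \<Rightarrow> vir \<Rightarrow> vir" where
  "vir_scale \<equiv> pm_scale (*)"

definition vir_d :: "int \<Rightarrow> vir" where
  "vir_d i = Poly_Mapping.single (Vir_d i) 1"

definition vir_c :: vir where
  "vir_c = Poly_Mapping.single Vir_c 1"

fun vir_basis_bracket :: "vir_basis \<Rightarrow> vir_basis \<Rightarrow> vir" where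
  "vir_basis_bracket (Vir_d i) (Vir_d j) =
     vir_scale (of_int (j - i)) (vir_d (i + j)) +
     (if i = - j then vir_scale (of_int (i ^ 3 - i) / 12) vir_c else 0)"
| "vir_basis_bracket _ _ = 0"

definition vir_bracket :: "vir \<Rightarrow> vir \<Rightarrow> vir" where
  "vir_bracket x y = lin_ext vir_scale (\<lambda>a. lin_ext vir_scale (vir_basis_bracket a) y) x"

definition virasoro :: "vir lie_structure" where
  "virasoro = \<lparr>lie_carrier = UNIV, lie_add = (+), lie_zero = 0, lie_scale = vir_scale,
     lie_bracket = vir_bracket\<rparr>"

definition vir_plus :: "vir lie_structure" where
  "vir_plus = virasoro\<lparr>lie_carrier := module.span vir_scale {vir_d i | i. i \<ge> 0}\<rparr>"

definition vir_plus_ideal :: "nat \<Rightarrow> vir set" where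
  "vir_plus_ideal r = lie_generated virasoro {vir_d i | i. i > int r}"

definition vir_quot :: "nat \<Rightarrow> vir set lie_structure" where
  "vir_quot r = lie_quotient vir_plus (vir_plus_ideal r)"

definition dbar :: "nat \<Rightarrow> nat \<Rightarrow> vir set" where
  "dbar r i = lie_coset vir_plus (vir_plus_ideal r) (vir_d (int i))"


section \<open>The Virasoro modules \<open>\<N>(M, \<alpha>)\<close>\<close>

text \<open>The space \<open>M \<otimes> \<complex>[t, t\<^sup>-\<^sup>1]\<close> is the type of finitely supported functions from the
  integers to \<open>M\<close>, where \<open>v \<otimes> t\<^sup>n\<close> is \<open>Poly_Mapping.single n v\<close> and the scalar multiplication is
  \<open>pm_scale s\<close>.\<close>

definition loop_coeff ::
  "nat \<Rightarrow> (complex \<Rightarrow> 'v::ab_group_add \<Rightarrow> 'v) \<Rightarrow> (vir set \<Rightarrow> 'v \<Rightarrow> 'v) \<Rightarrow> complex \<Rightarrow>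
    int \<Rightarrow> int \<Rightarrow> 'v \<Rightarrow> 'v" where
  "loop_coeff r s \<rho> \<alpha> m n v =
     s (\<alpha> + of_int n) v + (\<Sum>i\<le>r. s (of_int m ^ (i + 1) / fact (i + 1)) (\<rho> (dbar r i) v))"

fun loop_basis_act ::
  "nat \<Rightarrow> (complex \<Rightarrow> 'v::ab_group_add \<Rightarrow> 'v) \<Rightarrow> (vir set \<Rightarrow> 'v \<Rightarrow> 'v) \<Rightarrow> complex \<Rightarrow>
    vir_basis \<Rightarrow> (int \<Rightarrow>\<^sub>0 'v) \<Rightarrow> (int \<Rightarrow>\<^sub>0 'v)" where
  "loop_basis_act r s \<rho> \<alpha> (Vir_d m) w =
     (\<Sum>n\<in>Poly_Mapping.keys w.
        Poly_Mapping.single (n + m) (loop_coeff r s \<rho> \<alpha> m n (Poly_Mapping.lookup w n)))"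
| "loop_basis_act r s \<rho> \<alpha> Vir_c w = 0"

definition loop_act ::
  "nat \<Rightarrow> (complex \<Rightarrow> 'v::ab_group_add \<Rightarrow> 'v) \<Rightarrow> (vir set \<Rightarrow> 'v \<Rightarrow> 'v) \<Rightarrow> complex \<Rightarrow>
    vir \<Rightarrow> (int \<Rightarrow>\<^sub>0 'v) \<Rightarrow> (int \<Rightarrow>\<^sub>0 'v)" where
  "loop_act r s \<rho> \<alpha> x w = lin_ext (pm_scale s) (\<lambda>b. loop_basis_act r s \<rho> \<alpha> b w) x"


section \<open>Well-definedness\<close>

subsection \<open>Quotients of Lie algebras by ideals\<close>

lemma (in lie_algebra) add_zero_right: "x \<in> lie_carrier L \<Longrightarrow> lie_add L x (lie_zero L) = x"
  using add_commute add_zero zero_closed by metis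

lemma (in lie_algebra) add_left_commute:
  assumes "x \<in> lie_carrier L" "y \<in> lie_carrier L" "z \<in> lie_carrier L"
  shows "lie_add L x (lie_add L y z) = lie_add L y (lie_add L x z)"
  using assms add_assoc add_commute by metis

lemma (in lie_algebra) add_cancel:
  assumes "x \<in> lie_carrier L" "y \<in> lie_carrier L" "z \<in> lie_carrier L"
    and "lie_add L x y = lie_add L x z"
  shows "y = z"
proof -
  obtain u where u: "u \<in> lie_carrier L" "lie_add L x u = lie_zero L"
    using add_inverse assms(1) by blast
  have "lie_add L u (lie_add L x y) = lie_add L u (lie_add L x z)" using assms by simp
  then have "lie_add L (lie_add L u x) y = lie_add L (lie_add L u x) z"
    using add_assoc u assms by metis
  then show ?thesis using u assms add_commute add_zero by metis
qed

lemma (in lie_algebra) scale_zero: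
  assumes "x \<in> lie_carrier L"
  shows "lie_scale L 0 x = lie_zero L"
proof -
  have "lie_add L (lie_scale L 0 x) (lie_scale L 0 x) = lie_add L (lie_scale L 0 x) (lie_zero L)"
    using add_scale[OF assms, of 0 0] add_zero_right[OF scale_closed[OF assms]] by simp
  then show ?thesis using add_cancel scale_closed zero_closed assms by metis
qed

lemma (in lie_algebra) add_minus:
  assumes "x \<in> lie_carrier L"
  shows "lie_add L x (lie_scale L (-1) x) = lie_zero L"
  using add_scale[OF assms, of 1 "-1"] scale_one[OF assms] scale_zero[OF assms] by simp

lemma (in lie_algebra) bracket_swap:
  assumes x: "x \<in> lie_carrier L" and y: "y \<in> lie_carrier L"
  shows "lie_bracket L x y = lie_scale L (-1) (lie_bracket L y x)"
proof -
  have "lie_add L (lie_bracket L y x) (lie_bracket L x y) = lie_zero L"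
    using bracket_self[OF add_closed[OF x y]] bracket_add_left[OF x y add_closed[OF x y]]
      bracket_add_right[OF x y x] bracket_add_right[OF x y y] bracket_self[OF x] bracket_self[OF y]
      add_zero[OF bracket_closed[OF x y]] add_zero_right[OF bracket_closed[OF y x]]
      add_commute bracket_closed x y by metis
  then show ?thesis
    using add_minus[OF bracket_closed[OF y x]] add_cancel bracket_closed scale_closed x y by metis
qed

locale lie_algebra_ideal = lie_algebra L for L :: "'a lie_structure" +
  fixes I :: "'a set"
  assumes ideal: "lie_ideal L I"
begin

lemma ideal_carrier: "y \<in> I \<Longrightarrow> y \<in> lie_carrier L"
  and ideal_zero: "lie_zero L \<in> I"
  and ideal_add: "\<lbrakk>x \<in> I; y \<in> I\<rbrakk> \<Longrightarrow> lie_add L x y \<in> I"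
  and ideal_scale: "x \<in> I \<Longrightarrow> lie_scale L a x \<in> I"
  and ideal_bracket: "\<lbrakk>x \<in> lie_carrier L; y \<in> I\<rbrakk> \<Longrightarrow> lie_bracket L x y \<in> I"
  using ideal by (auto simp: lie_ideal_def lie_subspace_def)

lemma ideal_bracket_left: "\<lbrakk>x \<in> lie_carrier L; y \<in> I\<rbrakk> \<Longrightarrow> lie_bracket L y x \<in> I"
  using bracket_swap ideal_bracket ideal_scale ideal_carrier by metis

lemma coset_add:
  assumes x: "x \<in> lie_carrier L" and y: "y \<in> lie_carrier L"
  shows "lie_add (lie_quotient L I) (lie_coset L I x) (lie_coset L I y) = lie_coset L I (lie_add L x y)"
proof -
  have *: "lie_add L (lie_add L x i) (lie_add L y j) = lie_add L (lie_add L x y) (lie_add L i j)"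
    if "i \<in> I" "j \<in> I" for i j
    using x y ideal_carrier[OF that(1)] ideal_carrier[OF that(2)]
    by (simp add: add_assoc add_closed add_left_commute)
  have "lie_coset L I (lie_add L x y) \<subseteq>
      {lie_add L a b |a b. a \<in> lie_coset L I x \<and> b \<in> lie_coset L I y}"
  proof
    fix z assume "z \<in> lie_coset L I (lie_add L x y)"
    then obtain k where k: "k \<in> I" "z = lie_add L (lie_add L x y) k"
      by (auto simp: lie_coset_def)
    then have "z = lie_add L (lie_add L x (lie_zero L)) (lie_add L y k)"
      using *[OF ideal_zero k(1)] add_zero[OF ideal_carrier[OF k(1)]] by simp
    then show "z \<in> {lie_add L a b |a b. a \<in> lie_coset L I x \<and> b \<in> lie_coset L I y}"
      using k(1) ideal_zero unfolding lie_coset_def by blast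
  qed
  moreover have "{lie_add L a b |a b. a \<in> lie_coset L I x \<and> b \<in> lie_coset L I y}
      \<subseteq> lie_coset L I (lie_add L x y)"
    using * ideal_add unfolding lie_coset_def by blast
  ultimately show ?thesis
    by (simp add: lie_quotient_def subset_antisym)
qed

lemma coset_scale:
  assumes x: "x \<in> lie_carrier L"
  shows "lie_scale (lie_quotient L I) c (lie_coset L I x) = lie_coset L I (lie_scale L c x)"
proof -
  have *: "lie_add L (lie_scale L c (lie_add L x i)) j
      = lie_add L (lie_scale L c x) (lie_add L (lie_scale L c i) j)"
    if "i \<in> I" "j \<in> I" for i j
    using x ideal_carrier[OF that(1)] ideal_carrier[OF that(2)]
    by (simp add: add_assoc scale_closed scale_add)
  have "lie_coset L I (lie_scale L c x) \<subseteq>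
      {lie_add L (lie_scale L c a) y |a y. a \<in> lie_coset L I x \<and> y \<in> I}"
  proof
    fix z assume "z \<in> lie_coset L I (lie_scale L c x)"
    then obtain k where k: "k \<in> I" "z = lie_add L (lie_scale L c x) k"
      by (auto simp: lie_coset_def)
    then have "z = lie_add L (lie_scale L c (lie_add L x (lie_zero L))) k"
      using add_zero_right[OF x] by simp
    then show "z \<in> {lie_add L (lie_scale L c a) y |a y. a \<in> lie_coset L I x \<and> y \<in> I}"
      using k(1) ideal_zero unfolding lie_coset_def by blast
  qed
  moreover have "{lie_add L (lie_scale L c a) y |a y. a \<in> lie_coset L I x \<and> y \<in> I}
      \<subseteq> lie_coset L I (lie_scale L c x)"
    using * ideal_add ideal_scale unfolding lie_coset_def by blast
  ultimately show ?thesis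
    by (simp add: lie_quotient_def subset_antisym)
qed

lemma coset_bracket:
  assumes x: "x \<in> lie_carrier L" and y: "y \<in> lie_carrier L"
  shows "lie_bracket (lie_quotient L I) (lie_coset L I x) (lie_coset L I y)
    = lie_coset L I (lie_bracket L x y)"
proof -
  have *: "lie_add L (lie_bracket L (lie_add L x i) (lie_add L y j)) k
      = lie_add L (lie_bracket L x y)
         (lie_add L (lie_bracket L x j) (lie_add L (lie_bracket L i y) (lie_add L (lie_bracket L i j) k)))"
    if "i \<in> I" "j \<in> I" "k \<in> I" for i j k
    using x y ideal_carrier[OF that(1)] ideal_carrier[OF that(2)] ideal_carrier[OF that(3)]
    by (simp add: add_assoc add_closed bracket_closed bracket_add_left bracket_add_right
        add_left_commute)
  have **: "(lie_add L (lie_bracket L x j) (lie_add L (lie_bracket L i y) (lie_add L (lie_bracket L i j) k))) \<in> I"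
    if "i \<in> I" "j \<in> I" "k \<in> I" for i j k
    using that x y ideal_add ideal_bracket ideal_bracket_left ideal_carrier by simp
  have "lie_coset L I (lie_bracket L x y) \<subseteq>
      {lie_add L (lie_bracket L a b) k |a b k. a \<in> lie_coset L I x \<and> b \<in> lie_coset L I y \<and> k \<in> I}"
  proof
    fix z assume "z \<in> lie_coset L I (lie_bracket L x y)"
    then obtain k where k: "k \<in> I" "z = lie_add L (lie_bracket L x y) k"
      by (auto simp: lie_coset_def)
    then have "z = lie_add L (lie_bracket L (lie_add L x (lie_zero L)) (lie_add L y (lie_zero L))) k"
      using add_zero_right[OF x] add_zero_right[OF y] by simp
    then show "z \<in> {lie_add L (lie_bracket L a b) k |a b k.
        a \<in> lie_coset L I x \<and> b \<in> lie_coset L I y \<and> k \<in> I}"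
      using k(1) ideal_zero unfolding lie_coset_def by blast
  qed
  moreover have "{lie_add L (lie_bracket L a b) k |a b k.
        a \<in> lie_coset L I x \<and> b \<in> lie_coset L I y \<and> k \<in> I} \<subseteq> lie_coset L I (lie_bracket L x y)"
  proof
    fix z assume "z \<in> {lie_add L (lie_bracket L a b) k |a b k.
        a \<in> lie_coset L I x \<and> b \<in> lie_coset L I y \<and> k \<in> I}"
    then obtain i j k where "i \<in> I" "j \<in> I" "k \<in> I"
        "z = lie_add L (lie_bracket L (lie_add L x i) (lie_add L y j)) k"
      by (auto simp: lie_coset_def)
    then show "z \<in> lie_coset L I (lie_bracket L x y)"
      using *[of i j k] **[of i j k] unfolding lie_coset_def by blast
  qed
  ultimately show ?thesis
    by (simp add: lie_quotient_def subset_antisym)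
qed

lemma coset_zero: "lie_zero (lie_quotient L I) = lie_coset L I (lie_zero L)"
proof -
  have "lie_add L (lie_zero L) y = y" if "y \<in> I" for y
    using add_zero[OF ideal_carrier[OF that]] .
  then have "{lie_add L (lie_zero L) y |y. y \<in> I} = I"
    by force
  then show ?thesis
    by (simp add: lie_quotient_def lie_coset_def)
qed

lemma lie_algebra_quotient: "lie_algebra (lie_quotient L I)"
proof -
  have C: "lie_carrier (lie_quotient L I) = lie_coset L I ` lie_carrier L"
    by (simp add: lie_quotient_def)
  note coset = coset_add coset_scale coset_bracket coset_zero
  note closed = add_closed scale_closed bracket_closed zero_closed
  show ?thesis
  proof (intro lie_algebra.intro, unfold C)
    fix X assume "X \<in> lie_coset L I ` lie_carrier L"
    then show "\<exists>Y\<in>lie_coset L I ` lie_carrier L. lie_add (lie_quotient L I) X Y = lie_zero (lie_quotient L I)"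
      by (auto simp: coset) (metis add_inverse coset_add)
  next
    fix X Y Z assume "X \<in> lie_coset L I ` lie_carrier L" "Y \<in> lie_coset L I ` lie_carrier L"
      "Z \<in> lie_coset L I ` lie_carrier L"
    then show "lie_add (lie_quotient L I)
        (lie_bracket (lie_quotient L I) X (lie_bracket (lie_quotient L I) Y Z))
        (lie_add (lie_quotient L I) (lie_bracket (lie_quotient L I) Y (lie_bracket (lie_quotient L I) Z X))
          (lie_bracket (lie_quotient L I) Z (lie_bracket (lie_quotient L I) X Y)))
      = lie_zero (lie_quotient L I)"
      by (auto simp: coset closed jacobi)
  qed (auto simp: coset closed add_assoc add_commute add_left_commute add_zero add_zero_right scale_add add_scale scale_scale
      scale_one bracket_add_left bracket_add_right bracket_scale_left bracket_scale_right bracket_self)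
qed

end

subsection \<open>The Virasoro algebra is a Lie algebra\<close>

lemma lookup_pm_scale [simp]:
  assumes "s a 0 = 0"
  shows "Poly_Mapping.lookup (pm_scale s a w) i = s a (Poly_Mapping.lookup w i)"
  using assms unfolding pm_scale_def by transfer (simp add: when_def)

lemma vector_space_pm_scale:
  fixes s :: "complex \<Rightarrow> 'v::ab_group_add \<Rightarrow> 'v"
  assumes "vector_space s"
  shows "vector_space (pm_scale s :: complex \<Rightarrow> ('i \<Rightarrow>\<^sub>0 'v) \<Rightarrow> _)"
proof -
  interpret vector_space s by fact
  show ?thesis
    by unfold_locales (auto intro!: poly_mapping_eqI simp: lookup_add algebra_simps)
qed

lemma vector_space_vir_scale: "vector_space (pm_scale (*) :: complex \<Rightarrow> ('i \<Rightarrow>\<^sub>0 complex) \<Rightarrow> _)"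
  by (rule vector_space_pm_scale) (unfold_locales, simp_all add: algebra_simps)

lemma pm_scale_single:
  assumes "s a 0 = 0"
  shows "pm_scale s a (Poly_Mapping.single n v) = Poly_Mapping.single n (s a v)"
  using assms by (auto intro!: poly_mapping_eqI simp: lookup_single when_def)

lemma lin_ext_superset:
  assumes "vector_space s" "finite A" "Poly_Mapping.keys x \<subseteq> A"
  shows "lin_ext s f x = (\<Sum>b\<in>A. s (Poly_Mapping.lookup x b) (f b))"
proof -
  interpret vector_space s by fact
  show ?thesis
    unfolding lin_ext_def by (rule sum.mono_neutral_left) (use assms in \<open>auto simp: in_keys_iff\<close>)
qed

lemma lin_ext_add:
  assumes "vector_space s"
  shows "lin_ext s f (x + y) = lin_ext s f x + lin_ext s f y"
proof -
  interpret vector_space s by fact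
  let ?A = "Poly_Mapping.keys x \<union> Poly_Mapping.keys y"
  have "finite ?A" "Poly_Mapping.keys (x + y) \<subseteq> ?A" by (simp, rule keys_add)
  then show ?thesis
    using lin_ext_superset[OF assms, of ?A "x + y"] lin_ext_superset[OF assms, of ?A x]
      lin_ext_superset[OF assms, of ?A y]
    by (simp add: lookup_add scale_left_distrib sum.distrib)
qed

lemma lin_ext_scale:
  assumes "vector_space s"
  shows "lin_ext s f (pm_scale (*) a x) = s a (lin_ext s f x)"
proof -
  interpret vector_space s by fact
  have "finite (Poly_Mapping.keys x)" "Poly_Mapping.keys (pm_scale (*) a x) \<subseteq> Poly_Mapping.keys x"
    by (auto simp: in_keys_iff)
  then show ?thesis
    using lin_ext_superset[OF assms, of "Poly_Mapping.keys x"]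
    by (simp add: scale_sum_right)
qed

lemma lin_ext_single:
  assumes "vector_space s"
  shows "lin_ext s f (Poly_Mapping.single b a) = s a (f b)"
proof -
  interpret vector_space s by fact
  show ?thesis
    using lin_ext_superset[OF assms, of "{b}"] by simp
qed

lemma lin_ext_zero: "lin_ext s f 0 = 0"
  by (simp add: lin_ext_def)

lemma lin_ext_fun_add:
  assumes "vector_space s"
  shows "lin_ext s (\<lambda>b. f b + g b) x = lin_ext s f x + lin_ext s g x"
proof -
  interpret vector_space s by fact
  show ?thesis by (simp add: lin_ext_def scale_right_distrib sum.distrib)
qed

lemma lin_ext_fun_scale:
  assumes "vector_space s"
  shows "lin_ext s (\<lambda>b. s a (f b)) x = s a (lin_ext s f x)"
proof -
  interpret vector_space s by fact
  show ?thesis by (simp add: lin_ext_def scale_sum_right mult.commute)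
qed

lemma poly_mapping_sum_induct [case_names zero single add]:
  assumes "P 0" "\<And>b a. P (Poly_Mapping.single b a)" "\<And>x y. P x \<Longrightarrow> P y \<Longrightarrow> P (x + y)"
  shows "P (x :: 'b \<Rightarrow>\<^sub>0 'a::comm_monoid_add)"
proof (induction x rule: update_induct)
  case const
  then show ?case by (simp add: assms)
next
  case (update f a b)
  have "Poly_Mapping.update a b f = f + Poly_Mapping.single a b"
    by (rule poly_mapping_eqI) (use update in \<open>auto simp: lookup_update lookup_add lookup_single when_def in_keys_iff\<close>)
  then show ?case using assms update by simp
qed

lemmas vir_lin = lin_ext_add[OF vector_space_vir_scale] lin_ext_scale[OF vector_space_vir_scale]
  lin_ext_single[OF vector_space_vir_scale] lin_ext_fun_add[OF vector_space_vir_scale]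
  lin_ext_fun_scale[OF vector_space_vir_scale] lin_ext_zero

interpretation vir: vector_space vir_scale by (rule vector_space_vir_scale)

lemma vir_bracket_add_left: "vir_bracket (x + y) z = vir_bracket x z + vir_bracket y z"
  and vir_bracket_add_right: "vir_bracket z (x + y) = vir_bracket z x + vir_bracket z y"
  and vir_bracket_scale_left: "vir_bracket (vir_scale a x) y = vir_scale a (vir_bracket x y)"
  and vir_bracket_scale_right: "vir_bracket x (vir_scale a y) = vir_scale a (vir_bracket x y)"
  and vir_bracket_zero: "vir_bracket 0 x = 0" "vir_bracket x 0 = 0"
  by (simp_all add: vir_bracket_def vir_lin) (simp_all add: lin_ext_def)

lemmas vir_bilinear = vir_bracket_add_left vir_bracket_add_right vir_bracket_scale_left
  vir_bracket_scale_right vir_bracket_zero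

definition vir_e :: "vir_basis \<Rightarrow> vir" where
  "vir_e b = Poly_Mapping.single b 1"

lemma vir_single: "Poly_Mapping.single b a = vir_scale a (vir_e b)"
  by (rule poly_mapping_eqI) (simp add: lookup_single when_def vir_e_def)

lemma vir_bracket_basis: "vir_bracket (vir_e a) (vir_e b) = vir_basis_bracket a b"
  by (simp add: vir_bracket_def vir_e_def vir_lin)

lemma vir_d_e: "vir_d i = vir_e (Vir_d i)" and vir_c_e: "vir_c = vir_e Vir_c"
  by (simp_all add: vir_d_def vir_c_def vir_e_def)

lemma vir_induct [case_names zero e add scale]:
  assumes "P 0" "\<And>b. P (vir_e b)" "\<And>x y. P x \<Longrightarrow> P y \<Longrightarrow> P (x + y)"
    "\<And>a x. P x \<Longrightarrow> P (vir_scale a x)"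
  shows "P (x :: vir)"
  using assms by (induction x rule: poly_mapping_sum_induct) (simp_all add: vir_single)

lemma vir_bracket_d:
  "vir_bracket (vir_d i) (vir_d j) = vir_scale (of_int (j - i)) (vir_d (i + j)) +
     (if i = - j then vir_scale (of_int (i ^ 3 - i) / 12) vir_c else 0)"
  and vir_bracket_c: "vir_bracket vir_c x = 0" "vir_bracket x vir_c = 0"
proof -
  show "vir_bracket (vir_d i) (vir_d j) = vir_scale (of_int (j - i)) (vir_d (i + j)) +
     (if i = - j then vir_scale (of_int (i ^ 3 - i) / 12) vir_c else 0)"
    by (simp add: vir_d_e vir_bracket_basis del: vir_basis_bracket.simps) (simp add: vir_d_e)
  have "vir_basis_bracket b Vir_c = 0" for b by (cases b) auto
  then show "vir_bracket vir_c x = 0" "vir_bracket x vir_c = 0"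
    by (induction x rule: vir_induct) (simp_all add: vir_bilinear vir_c_e vir_bracket_basis)
qed

lemma vir_bracket_swap: "vir_bracket x y = - vir_bracket y x"
proof (induction x rule: vir_induct)
  case (e a)
  show ?case
  proof (induction y rule: vir_induct)
    case (e b)
    show ?case
    proof (cases a; cases b)
      fix i j assume "a = Vir_d i" "b = Vir_d j"
      moreover have "vir_bracket (vir_d i) (vir_d j) = - vir_bracket (vir_d j) (vir_d i)"
        unfolding vir_bracket_d
        by (rule poly_mapping_eqI) (auto simp: lookup_add lookup_minus add.commute algebra_simps diff_divide_distrib)
      ultimately show ?thesis
        by (simp add: vir_d_e)
    qed (simp_all add: vir_bracket_basis)
  qed (simp_all add: vir_bilinear)
qed (simp_all add: vir_bilinear)

lemma vir_jacobi:
  "vir_bracket x (vir_bracket y z) + (vir_bracket y (vir_bracket z x) + vir_bracket z (vir_bracket x y)) = 0"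
  (is "?J x y z = 0")
proof -
  have lin: "?J (x + x') y z = ?J x y z + ?J x' y z" "?J x (y + y') z = ?J x y z + ?J x y' z"
    "?J x y (z + z') = ?J x y z + ?J x y z'" "?J (vir_scale a x) y z = vir_scale a (?J x y z)"
    "?J x (vir_scale a y) z = vir_scale a (?J x y z)" "?J x y (vir_scale a z) = vir_scale a (?J x y z)"
    for x x' y y' z z' a
    by (simp_all add: vir_bilinear vir.scale_right_distrib)
  have d: "?J (vir_d i) (vir_d j) (vir_d k) = 0" for i j k
  proof -
    have inner: "vir_bracket (vir_d i) (vir_bracket (vir_d j) (vir_d k))
        = vir_scale (of_int (k - j)) (vir_bracket (vir_d i) (vir_d (j + k)))" for i j k
      unfolding vir_bracket_d[of j k] by (simp add: vir_bilinear vir_bracket_c)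
    show ?thesis
    proof (cases "i + j + k = 0")
      case True
      then have k: "k = - i - j" by simp
      show ?thesis
        unfolding inner unfolding vir_bracket_d k
        by (rule poly_mapping_eqI) (simp add: lookup_add lookup_minus, simp add: field_simps power3_eq_cube)
    next
      case False
      then have ne: "i \<noteq> - (j + k)" "j \<noteq> - (k + i)" "k \<noteq> - (i + j)" by auto
      have [simp]: "j + (k + i) = i + (j + k)" "k + (i + j) = i + (j + k)" by auto
      show ?thesis
        unfolding inner unfolding vir_bracket_d ne[THEN if_not_P]
        by (rule poly_mapping_eqI) (simp add: lookup_add lookup_minus, simp add: algebra_simps)
    qed
  qed
  show ?thesis
  proof (induction x rule: vir_induct)
    case (e a)
    show ?case
    proof (induction y rule: vir_induct)
      case (e b)
      show ?case
      proof (induction z rule: vir_induct)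
        case (e c)
        show ?case
        proof (cases "a = Vir_c \<or> b = Vir_c \<or> c = Vir_c")
          case True
          then show ?thesis by (auto simp: vir_c_e[symmetric] vir_bracket_c vir_bilinear)
        next
          case False
          then obtain i j k where "a = Vir_d i" "b = Vir_d j" "c = Vir_d k"
            by (meson vir_basis.exhaust)
          then show ?thesis using d by (simp add: vir_d_e)
        qed
      qed (simp_all only: lin, simp_all add: vir_bilinear)
    qed (simp_all only: lin, simp_all add: vir_bilinear)
  qed (simp_all only: lin, simp_all add: vir_bilinear)
qed

lemma lie_algebra_virasoro: "lie_algebra virasoro"
proof (unfold virasoro_def, rule lie_algebra.intro, simp_all add: vir_bilinear vir_jacobi)
  fix x y :: vir
  show "\<exists>y. x + y = 0" by (rule exI[of _ "- x"]) simp
  show "vir_bracket x x = 0"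
  proof (rule poly_mapping_eqI)
    fix b
    have "Poly_Mapping.lookup (vir_bracket x x) b = - Poly_Mapping.lookup (vir_bracket x x) b"
      using vir_bracket_swap[of x x] by (metis lookup_uminus)
    then show "Poly_Mapping.lookup (vir_bracket x x) b = Poly_Mapping.lookup 0 b"
      by (simp add: equation_minus_iff)
  qed
qed (simp_all add: add_ac vir.scale_right_distrib vir.scale_left_distrib)

subsection \<open>The quotient algebras\<close>

definition vir_supp :: "int \<Rightarrow> vir set" where
  "vir_supp r = {x. Poly_Mapping.keys x \<subseteq> Vir_d ` {r<..}}"

lemma vir_supp_iff: "x \<in> vir_supp r \<longleftrightarrow>
    Poly_Mapping.lookup x Vir_c = 0 \<and> (\<forall>i\<le>r. Poly_Mapping.lookup x (Vir_d i) = 0)"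
proof -
  have "b \<in> Vir_d ` {r<..} \<longleftrightarrow> b \<noteq> Vir_c \<and> (\<forall>i\<le>r. b \<noteq> Vir_d i)" for b
    by (cases b) (auto simp: image_iff not_le)
  then show ?thesis
    by (auto simp: vir_supp_def in_keys_iff subset_iff)
qed

lemma vir_expand: "x = (\<Sum>b\<in>Poly_Mapping.keys x. vir_scale (Poly_Mapping.lookup x b) (vir_e b))"
  by (rule poly_mapping_eqI)
    (simp add: lookup_sum vir_e_def lookup_single when_def mult.commute if_distrib in_keys_iff
      sum.delta' cong: if_cong)

lemma vir_supp_span: "vir_supp r = vir.span {vir_d i | i. i > r}"
proof
  show "vir.span {vir_d i | i. i > r} \<subseteq> vir_supp r"
    by (rule vir.span_minimal)
      (auto simp: vir.subspace_def vir_supp_iff lookup_add vir_d_def lookup_single when_def)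
  show "vir_supp r \<subseteq> vir.span {vir_d i | i. i > r}"
  proof
    fix x assume "x \<in> vir_supp r"
    then have "vir_e b \<in> vir.span {vir_d i | i. i > r}" if "b \<in> Poly_Mapping.keys x" for b
      using that by (intro vir.span_base) (auto simp: vir_supp_def vir_d_e)
    then show "x \<in> vir.span {vir_d i | i. i > r}"
      by (subst vir_expand) (intro vir.span_sum vir.span_scale)
  qed
qed

lemma subspace_vir_supp: "vir.subspace (vir_supp r)"
  by (simp add: vir_supp_span)

lemma vir_supp_d: "i > r \<Longrightarrow> vir_d i \<in> vir_supp r"
  by (simp add: vir_supp_iff vir_d_def lookup_single)

lemma vir_supp_bracket:
  assumes x: "x \<in> vir_supp (- 1)" and y: "y \<in> vir_supp r" and r: "r \<ge> - 1"
  shows "vir_bracket x y \<in> vir_supp r"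
proof -
  have d: "vir_bracket (vir_d i) (vir_d j) \<in> vir_supp r" if "i > - 1" "j > r" for i j
  proof -
    have "(if i = - j then vir_scale (of_int (i ^ 3 - i) / 12) vir_c else 0) = 0"
    proof (cases "i = - j")
      case True
      then have "i = 0" using that r by auto
      then show ?thesis by simp
    qed simp
    then show ?thesis
      using that unfolding vir_bracket_d
      by (auto intro!: vir.subspace_add vir.subspace_scale subspace_vir_supp vir_supp_d
          simp: vir.subspace_0[OF subspace_vir_supp])
  qed
  have "vir.subspace {x. \<forall>y\<in>vir_supp r. vir_bracket x y \<in> vir_supp r}"
    using subspace_vir_supp[of r] by (auto simp: vir.subspace_def vir_bilinear)
  moreover have "vir_bracket (vir_d i) y \<in> vir_supp r" if i: "i > - 1" and y: "y \<in> vir_supp r" for i y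
  proof -
    have "vir.subspace {y. vir_bracket (vir_d i) y \<in> vir_supp r}"
      using subspace_vir_supp[of r] by (auto simp: vir.subspace_def vir_bilinear)
    then have "vir.span {vir_d j | j. j > r} \<subseteq> {y. vir_bracket (vir_d i) y \<in> vir_supp r}"
      by (intro vir.span_minimal) (use d i in auto)
    then show ?thesis using y by (auto simp: vir_supp_span)
  qed
  ultimately have "vir.span {vir_d i | i. i > - 1} \<subseteq> {x. \<forall>y\<in>vir_supp r. vir_bracket x y \<in> vir_supp r}"
    by (intro vir.span_minimal) auto
  then show ?thesis using x y by (auto simp: vir_supp_span)
qed

lemma vir_supp_mono: "r \<le> r' \<Longrightarrow> vir_supp r' \<subseteq> vir_supp r"
  by (auto simp: vir_supp_def)

lemma vir_plus_simps [simp]: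
  "lie_carrier vir_plus = vir_supp (- 1)" "lie_add vir_plus = (+)" "lie_zero vir_plus = 0"
  "lie_scale vir_plus = vir_scale" "lie_bracket vir_plus = vir_bracket"
proof -
  have "{vir_d i | i. i \<ge> 0} = {vir_d i | i. i > - 1}" by force
  then show "lie_carrier vir_plus = vir_supp (- 1)"
    by (simp add: vir_plus_def vir_supp_span)
qed (simp_all add: vir_plus_def virasoro_def)

lemma lie_algebra_vir_plus: "lie_algebra vir_plus"
proof -
  interpret V: lie_algebra virasoro by (rule lie_algebra_virasoro)
  note V = V.add_assoc V.add_commute V.scale_add V.add_scale V.bracket_self V.jacobi
  note subspace = vir.subspace_add vir.subspace_scale vir.subspace_0
  show ?thesis
  proof (rule lie_algebra.intro, simp_all add: vir_bilinear subspace subspace_vir_supp vir_jacobi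
      vir_supp_bracket)
    fix x y assume "x \<in> vir_supp (- 1)"
    then show "\<exists>y\<in>vir_supp (- 1). x + y = 0"
      by (intro bexI[of _ "- x"]) (simp_all add: vir.subspace_neg[OF subspace_vir_supp])
    show "vir_bracket x x = 0" using V.bracket_self[of x] by (simp add: virasoro_def)
  qed (simp_all add: add_ac vir.scale_right_distrib vir.scale_left_distrib)
qed

lemma vir_plus_ideal_eq: "vir_plus_ideal r = vir_supp (int r)"
proof
  have "lie_subalgebra virasoro (vir_supp (int r))"
    using vir_supp_bracket[of _ _ "int r"] vir_supp_mono[of "-1" "int r"] subspace_vir_supp[of "int r"]
    by (auto simp: lie_subalgebra_def lie_subspace_def virasoro_def vir.subspace_def)
  moreover have "{vir_d i | i. i > int r} \<subseteq> vir_supp (int r)"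
    using vir_supp_d by auto
  ultimately show "vir_plus_ideal r \<subseteq> vir_supp (int r)"
    unfolding vir_plus_ideal_def lie_generated_def by blast
  show "vir_supp (int r) \<subseteq> vir_plus_ideal r"
    unfolding vir_plus_ideal_def lie_generated_def
  proof (rule Inter_greatest)
    fix S assume "S \<in> {S. lie_subalgebra virasoro S \<and> {vir_d i | i. i > int r} \<subseteq> S}"
    then show "vir_supp (int r) \<subseteq> S"
      unfolding vir_supp_span
      by (intro vir.span_minimal)
        (auto simp: lie_subalgebra_def lie_subspace_def virasoro_def vir.subspace_def)
  qed
qed

lemma lie_ideal_vir_plus_ideal: "lie_ideal vir_plus (vir_plus_ideal r)"
  using vir_supp_bracket[of _ _ "int r"] vir_supp_mono[of "-1" "int r"] subspace_vir_supp[of "int r"]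
  by (auto simp: vir_plus_ideal_eq lie_ideal_def lie_subspace_def vir.subspace_def)

interpretation vir_ideal: lie_algebra_ideal vir_plus "vir_plus_ideal r" for r
  using lie_algebra_vir_plus lie_ideal_vir_plus_ideal
  by (simp add: lie_algebra_ideal_def lie_algebra_ideal_axioms_def)

lemma lie_algebra_vir_quot: "lie_algebra (vir_quot r)"
  unfolding vir_quot_def by (rule vir_ideal.lie_algebra_quotient)

lemma dbar_carrier: "dbar r i \<in> lie_carrier (vir_quot r)"
  unfolding vir_quot_def dbar_def lie_quotient_def
  by (auto intro!: imageI vir_supp_d)

lemma dbar_bracket:
  "lie_bracket (vir_quot r) (dbar r i) (dbar r j) =
     lie_scale (vir_quot r) (of_int (int j - int i)) (dbar r (i + j))"
proof -
  have "vir_bracket (vir_d (int i)) (vir_d (int j)) = vir_scale (of_int (int j - int i)) (vir_d (int (i + j)))"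
    unfolding vir_bracket_d by (cases "i = 0") auto
  then show ?thesis
    by (simp add: vir_quot_def dbar_def vir_supp_d vir_ideal.coset_bracket vir_ideal.coset_scale)
qed

lemma dbar_zero_iff: "dbar r i = lie_zero (vir_quot r) \<longleftrightarrow> i > r"
proof -
  have "lie_zero (vir_quot r) = vir_supp (int r)"
    by (simp add: vir_quot_def lie_quotient_def vir_plus_ideal_eq)
  moreover have "dbar r i = vir_supp (int r) \<longleftrightarrow> vir_d (int i) \<in> vir_supp (int r)"
  proof
    assume *: "dbar r i = vir_supp (int r)"
    have "lie_add vir_plus (vir_d (int i)) 0 \<in> dbar r i"
      unfolding dbar_def lie_coset_def vir_plus_ideal_eq
      using vir.subspace_0[OF subspace_vir_supp[of "int r"]] by blast
    then show "vir_d (int i) \<in> vir_supp (int r)"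
      by (simp add: *)
  next
    assume *: "vir_d (int i) \<in> vir_supp (int r)"
    have "y \<in> dbar r i" if "y \<in> vir_supp (int r)" for y
      unfolding dbar_def lie_coset_def vir_plus_ideal_eq
    proof (intro CollectI exI conjI)
      show "y = lie_add vir_plus (vir_d (int i)) (y - vir_d (int i))" by simp
      show "y - vir_d (int i) \<in> vir_supp (int r)"
        by (rule vir.subspace_diff[OF subspace_vir_supp that *])
    qed
    moreover have "y \<in> vir_supp (int r)" if "y \<in> dbar r i" for y
      using that vir.subspace_add[OF subspace_vir_supp *]
      unfolding dbar_def lie_coset_def vir_plus_ideal_eq by auto
    ultimately show "dbar r i = vir_supp (int r)" by blast
  qed
  moreover have "vir_d (int i) \<in> vir_supp (int r) \<longleftrightarrow> i > r"
    by (auto simp: vir_supp_iff vir_d_def lookup_single when_def)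
  ultimately show ?thesis by simp
qed

subsection \<open>\<open>\<N>(M, \<alpha>)\<close> is a module over the Virasoro algebra\<close>

lemma pow_fact_add:
  fixes x y :: complex
  shows "(x + y) ^ n / fact n = (\<Sum>i\<le>n. (x ^ i / fact i) * (y ^ (n - i) / fact (n - i)))"
  using exp_series_add_commuting[of x y n]
  by (simp add: mult.commute divide_inverse scaleR_conv_of_real)

lemma loop_scalar_identity:
  fixes m k :: complex
  defines "e \<equiv> \<lambda>x n. x ^ n / (fact n :: complex)"
  shows "(\<Sum>i\<le>l. e m (i + 1) * e k (l - i + 1) * (of_nat (l - i) - of_nat i)) =
    (k - m) * e (m + k) (l + 1) - k * e k (l + 1) + m * e m (l + 1)"
proof -
  have e: "e x (n + 1) * (1 + of_nat n) = x * e x n" for x n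
  proof -
    have "fact (n + 1) = (1 + of_nat n) * (fact n :: complex)" "1 + of_nat n \<noteq> (0 :: complex)"
      using of_nat_neq_0[of n] by (simp_all add: algebra_simps)
    then show ?thesis by (simp add: e_def)
  qed
  have "e m (i + 1) * e k (l - i + 1) * (of_nat (l - i) - of_nat i) =
      k * (e m (i + 1) * e k (l - i)) - m * (e m i * e k (l - i + 1))" for i
  proof -
    have "e m (i + 1) * e k (l - i + 1) * (of_nat (l - i) - of_nat i) =
      e m (i + 1) * (e k (l - i + 1) * (1 + of_nat (l - i)))
        - (e m (i + 1) * (1 + of_nat i)) * e k (l - i + 1)"
      by (simp add: algebra_simps)
    then show ?thesis unfolding e by (simp add: algebra_simps)
  qed
  then have S: "(\<Sum>i\<le>l. e m (i + 1) * e k (l - i + 1) * (of_nat (l - i) - of_nat i)) =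
      k * (\<Sum>i\<le>l. e m (i + 1) * e k (l - i)) - m * (\<Sum>i\<le>l. e m i * e k (l - i + 1))"
    by (simp only: sum_subtractf sum_distrib_left)
  have S1: "e (m + k) (l + 1) = e k (l + 1) + (\<Sum>i\<le>l. e m (i + 1) * e k (l - i))"
  proof -
    have "e (m + k) (l + 1) = (\<Sum>i\<le>Suc l. e m i * e k (Suc l - i))"
      unfolding e_def pow_fact_add by simp
    also have "\<dots> = e k (l + 1) + (\<Sum>i\<le>l. e m (i + 1) * e k (l - i))"
      by (subst sum.atMost_Suc_shift) (simp add: e_def)
    finally show ?thesis .
  qed
  have S2: "e (m + k) (l + 1) = e m (l + 1) + (\<Sum>i\<le>l. e m i * e k (l - i + 1))"
  proof -
    have "e (m + k) (l + 1) = (\<Sum>i\<le>Suc l. e m i * e k (Suc l - i))"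
      unfolding e_def pow_fact_add by simp
    also have "\<dots> = (\<Sum>i\<le>l. e m i * e k (Suc l - i)) + e m (l + 1)"
      by (subst sum.atMost_Suc) (simp add: e_def)
    also have "(\<Sum>i\<le>l. e m i * e k (Suc l - i)) = (\<Sum>i\<le>l. e m i * e k (l - i + 1))"
      by (rule sum.cong) (auto simp: Suc_diff_le)
    finally show ?thesis by simp
  qed
  have "(\<Sum>i\<le>l. e m (i + 1) * e k (l - i)) = e (m + k) (l + 1) - e k (l + 1)"
    "(\<Sum>i\<le>l. e m i * e k (l - i + 1)) = e (m + k) (l + 1) - e m (l + 1)"
    by (simp only: S1, simp) (simp only: S2, simp)
  then show ?thesis unfolding S by (simp only:) (simp add: algebra_simps)
qed

locale vir_quot_module = lie_module "vir_quot r" s \<rho>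
  for r :: nat and s :: "complex \<Rightarrow> 'v::ab_group_add \<Rightarrow> 'v" and \<rho> +
  fixes \<alpha> :: complex
begin

abbreviation E :: "nat \<Rightarrow> 'v \<Rightarrow> 'v" where
  "E i \<equiv> \<rho> (dbar r i)"

definition X :: "complex \<Rightarrow> 'v \<Rightarrow> 'v" where
  "X m v = (\<Sum>i\<le>r. s (m ^ (i + 1) / fact (i + 1)) (E i v))"

lemma E_linear: "Vector_Spaces.linear s s (E i)"
  by (rule act_linear[OF dbar_carrier])

lemma E_module_hom: "module_hom s s (E i)"
  using E_linear by (simp add: Vector_Spaces.linear_def)

lemmas E_simps = module_hom.add[OF E_module_hom] module_hom.scale[OF E_module_hom]
  module_hom.zero[OF E_module_hom] module_hom.sum[OF E_module_hom]

lemma E_zero: "E i v = 0" if "i > r"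
proof -
  have "lie_scale (vir_quot r) 0 (dbar r i) = dbar r i"
    using that lie.scale_zero[OF dbar_carrier, of i] dbar_zero_iff[of r i] by metis
  then show ?thesis
    using act_scale[OF dbar_carrier, of 0 i v] by simp
qed

lemma E_commutator: "E i (E j v) - E j (E i v) = s (of_nat j - of_nat i) (E (i + j) v)"
  using act_bracket[OF dbar_carrier dbar_carrier, of i j v]
  by (simp add: dbar_bracket act_scale dbar_carrier)

lemma X_linear: "X m (v + w) = X m v + X m w" "X m (s a v) = s a (X m v)" "X m 0 = 0"
  by (simp_all add: X_def E_simps scale_right_distrib sum.distrib scale_sum_right mult.commute)

lemma X_commutator:
  "X m (X k v) - X k (X m v) = s (k - m) (X (m + k) v) - s k (X k v) + s m (X m v)"
proof -
  let ?e = "\<lambda>x n. x ^ n / (fact n :: complex)"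
  let ?f = "\<lambda>i j. s (?e m (i + 1) * ?e k (j + 1) * (of_nat j - of_nat i)) (E (i + j) v)"
  have "X m (X k v) = (\<Sum>i\<le>r. \<Sum>j\<le>r. s (?e m (i + 1) * ?e k (j + 1)) (E i (E j v)))"
    by (simp add: X_def E_simps scale_sum_right)
  moreover have "X k (X m v) = (\<Sum>j\<le>r. \<Sum>i\<le>r. s (?e m (i + 1) * ?e k (j + 1)) (E j (E i v)))"
    by (simp add: X_def E_simps scale_sum_right mult.commute)
  ultimately have "X m (X k v) - X k (X m v) = (\<Sum>i\<le>r. \<Sum>j\<le>r. 
      s (?e m (i + 1) * ?e k (j + 1)) (E i (E j v) - E j (E i v)))"
    by (subst (asm) (2) sum.swap) (simp add: sum_subtractf scale_right_diff_distrib)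
  also have "\<dots> = (\<Sum>i\<le>r. \<Sum>j\<le>r. ?f i j)"
    unfolding E_commutator by simp
  also have "\<dots> = (\<Sum>(i, j)\<in>{..r} \<times> {..r}. ?f i j)"
    by (simp add: sum.cartesian_product)
  also have "\<dots> = (\<Sum>(i, j)\<in>{(i, j). i + j \<le> r}. ?f i j)"
  proof (rule sum.mono_neutral_right)
    show "\<forall>p\<in>{..r} \<times> {..r} - {(i, j). i + j \<le> r}. (case p of (i, j) \<Rightarrow> ?f i j) = 0"
    proof
      fix p assume "p \<in> {..r} \<times> {..r} - {(i, j). i + j \<le> r}"
      then obtain i j where "p = (i, j)" "i + j > r" by auto
      then show "(case p of (i, j) \<Rightarrow> ?f i j) = 0" by (simp add: E_zero)
    qed
  qed auto
  also have "\<dots> = (\<Sum>l\<le>r. \<Sum>i\<le>l. ?f i (l - i))"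
    by (rule sum.triangle_reindex_eq)
  also have "\<dots> = (\<Sum>l\<le>r. s (\<Sum>i\<le>l. ?e m (i + 1) * ?e k (l - i + 1) * (of_nat (l - i) - of_nat i)) (E l v))"
    by (simp add: scale_sum_left)
  also have "\<dots> = (\<Sum>l\<le>r. s ((k - m) * ?e (m + k) (l + 1) - k * ?e k (l + 1) + m * ?e m (l + 1)) (E l v))"
    unfolding loop_scalar_identity ..
  also have "\<dots> = s (k - m) (X (m + k) v) - s k (X k v) + s m (X m v)"
    unfolding X_def scale_sum_right
    by (simp add: sum.distrib sum_subtractf scale_left_distrib scale_left_diff_distrib
        del: of_nat_Suc power_Suc fact_Suc)
  finally show ?thesis .
qed

abbreviation T :: "int \<Rightarrow> int \<Rightarrow> 'v \<Rightarrow> 'v" where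
  "T \<equiv> loop_coeff r s \<rho> \<alpha>"

lemma T_eq: "T m n v = s (\<alpha> + of_int n) v + X (of_int m) v"
  by (simp add: loop_coeff_def X_def)

lemma T_linear: "T m n (v + w) = T m n v + T m n w" "T m n (s a v) = s a (T m n v)" "T m n 0 = 0"
  by (simp_all add: T_eq X_linear scale_right_distrib mult.commute)

lemma T_commutator:
  "T i (n + j) (T j n v) - T j (n + i) (T i n v) = s (of_int (j - i)) (T (i + j) n v)"
proof -
  have "T i (n + j) (T j n v) - T j (n + i) (T i n v) =
    s ((\<alpha> + of_int (n + j)) * (\<alpha> + of_int n) - (\<alpha> + of_int (n + i)) * (\<alpha> + of_int n)) v
    + s (of_int j) (X (of_int j) v) - s (of_int i) (X (of_int i) v)
    + (X (of_int i) (X (of_int j) v) - X (of_int j) (X (of_int i) v))"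
    by (simp add: T_eq X_linear scale_right_distrib scale_left_distrib scale_left_diff_distrib
        algebra_simps)
  also have "\<dots> = s (of_int (j - i) * (\<alpha> + of_int n)) v + s (of_int (j - i)) (X (of_int (i + j)) v)"
    unfolding X_commutator by (simp add: algebra_simps)
  finally show ?thesis
    by (simp add: T_eq scale_right_distrib del: of_int_diff)
qed

abbreviation A :: "vir_basis \<Rightarrow> (int \<Rightarrow>\<^sub>0 'v) \<Rightarrow> (int \<Rightarrow>\<^sub>0 'v)" where
  "A \<equiv> loop_basis_act r s \<rho> \<alpha>"

abbreviation N :: "vir \<Rightarrow> (int \<Rightarrow>\<^sub>0 'v) \<Rightarrow> (int \<Rightarrow>\<^sub>0 'v)" where
  "N \<equiv> loop_act r s \<rho> \<alpha>"

lemma lookup_A: "Poly_Mapping.lookup (A (Vir_d m) w) k = T m (k - m) (Poly_Mapping.lookup w (k - m))"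
proof -
  have "Poly_Mapping.lookup (A (Vir_d m) w) k =
      (\<Sum>n\<in>Poly_Mapping.keys w. if n = k - m then T m n (Poly_Mapping.lookup w n) else 0)"
    unfolding loop_basis_act.simps lookup_sum
    by (rule sum.cong) (auto simp: lookup_single when_def)
  also have "\<dots> = (if k - m \<in> Poly_Mapping.keys w then T m (k - m) (Poly_Mapping.lookup w (k - m)) else 0)"
    by (rule sum.delta) simp
  finally show ?thesis
    by (auto simp: in_keys_iff T_linear)
qed

sublocale loop: vector_space "pm_scale s :: complex \<Rightarrow> (int \<Rightarrow>\<^sub>0 'v) \<Rightarrow> _"
  by (rule vector_space_pm_scale) (rule vector_space_axioms)

lemma A_linear: "A b (w + w') = A b w + A b w'" "A b (pm_scale s a w) = pm_scale s a (A b w)"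
  by (cases b; auto intro!: poly_mapping_eqI simp: lookup_A lookup_add T_linear
      simp del: loop_basis_act.simps(1))+

lemma N_linear: "N x (w + w') = N x w + N x w'" "N x (pm_scale s a w) = pm_scale s a (N x w)"
  by (simp_all only: loop_act_def A_linear lin_ext_fun_add[OF loop.vector_space_axioms]
      lin_ext_fun_scale[OF loop.vector_space_axioms])

lemma N_linear_left: "N (x + y) w = N x w + N y w" "N (vir_scale a x) w = pm_scale s a (N x w)"
    "N 0 w = 0"
  by (simp_all only: loop_act_def lin_ext_add[OF loop.vector_space_axioms]
      lin_ext_scale[OF loop.vector_space_axioms] lin_ext_zero)

lemma N_zero: "N x 0 = 0"
  using N_linear(1)[of x 0 0] by simp

lemma N_basis: "N (vir_e b) w = A b w"
  by (simp add: loop_act_def vir_e_def lin_ext_single[OF loop.vector_space_axioms])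

lemma N_single: "N (vir_d m) (Poly_Mapping.single n v) = Poly_Mapping.single (n + m) (T m n v)"
  by (rule poly_mapping_eqI)
    (auto simp: vir_d_e N_basis lookup_A lookup_single when_def T_linear simp del: loop_basis_act.simps(1))

lemma N_c: "N vir_c w = 0"
  by (simp add: vir_c_e N_basis)

lemma N_bracket: "N (vir_bracket x y) w = N x (N y w) - N y (N x w)"
proof (induction x rule: vir_induct)
  case (e a)
  show ?case
  proof (induction y rule: vir_induct)
    case (e b)
    show ?case
    proof (cases "a = Vir_c \<or> b = Vir_c")
      case True
      then show ?thesis
        by (auto simp flip: vir_c_e simp: vir_bracket_c N_c N_zero N_linear_left)
    next
      case False
      then obtain i j where ij: "a = Vir_d i" "b = Vir_d j"
        by (meson vir_basis.exhaust)
      have "N (vir_bracket (vir_d i) (vir_d j)) w = pm_scale s (of_int (j - i)) (A (Vir_d (i + j)) w)"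
        unfolding vir_bracket_d
        by (simp add: N_linear_left N_c vir_d_e N_basis del: loop_basis_act.simps(1))
      moreover have "A (Vir_d i) (A (Vir_d j) w) - A (Vir_d j) (A (Vir_d i) w)
          = pm_scale s (of_int (j - i)) (A (Vir_d (i + j)) w)"
      proof (rule poly_mapping_eqI)
        fix k
        show "Poly_Mapping.lookup (A (Vir_d i) (A (Vir_d j) w) - A (Vir_d j) (A (Vir_d i) w)) k =
          Poly_Mapping.lookup (pm_scale s (of_int (j - i)) (A (Vir_d (i + j)) w)) k"
          using T_commutator[of i "k - i - j" j "Poly_Mapping.lookup w (k - i - j)"]
          by (simp add: lookup_minus lookup_A del: loop_basis_act.simps(1))
            (simp add: algebra_simps)
      qed
      ultimately show ?thesis by (simp add: ij vir_d_e N_basis)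
    qed
  qed (simp_all add: vir_bilinear N_linear_left N_linear N_zero loop.scale_right_diff_distrib)
qed (simp_all add: vir_bilinear N_linear_left N_linear N_zero loop.scale_right_diff_distrib)

lemma lie_module_loop: "lie_module virasoro (pm_scale s) N"
proof -
  interpret V: lie_algebra virasoro by (rule lie_algebra_virasoro)
  show ?thesis
  proof (intro lie_module.intro lie_module_axioms.intro V.lie_algebra_axioms loop.vector_space_axioms)
    fix x
    show "Vector_Spaces.linear (pm_scale s) (pm_scale s) (N x)"
      by (simp add: Vector_Spaces.linear_def module_hom_def module_hom_axioms_def
          loop.vector_space_axioms loop.module_axioms N_linear)
  qed (simp_all add: virasoro_def N_linear_left N_bracket)
qed

end

end

theory Submission
  imports Defs
begin

text \<open>
  Two facts carry the proof: the spectrum of \<open>d\<^sub>0\<close>, and the way in which the action of \<open>d\<^sub>m\<close>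
  depends on \<open>m\<close>, which is polynomial.

  \<^item> On \<open>\<N>(M, \<alpha>)\<close> the element \<open>d\<^sub>0\<close> acts diagonally, with eigenspace \<open>M \<otimes> t\<^sup>n\<close> for the eigenvalue
    \<open>\<alpha> + n\<close>. An isomorphism \<open>\<phi>\<close> preserves eigenvalues, so \<open>\<alpha> - \<alpha>'\<close> is an integer \<open>k\<close> and
    \<open>\<phi>(v \<otimes> t\<^sup>n) = f\<^sub>n(v) \<otimes> t\<^bsup>n+k\<^esup>\<close> with linear bijections \<open>f\<^sub>n : M \<rightarrow> M'\<close>, one for each degree.
    Write \<open>T\<^bsub>m,n\<^esub>\<close> for the operator on \<open>M\<close> through which \<open>d\<^sub>m\<close> maps degree \<open>n\<close> to degree \<open>n + m\<close>; then
    \<open>f\<^bsub>n+m\<^esub> T\<^bsub>m,n\<^esub> = T'\<^bsub>m,n+k\<^esub> f\<^sub>n\<close>.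

  \<^item> The path from degree \<open>n\<close> to degree \<open>q\<close> via \<open>n + x\<close> gives the operator \<open>d\<^bsub>q-n-x\<^esub> d\<^sub>x\<close>. Its end points,
    and hence the maps \<open>f\<^sub>n\<close> and \<open>f\<^sub>q\<close> that intertwine it, do not depend on \<open>x\<close>, while the operator is,
    for \<open>r \<ge> 1\<close>, a polynomial in \<open>x\<close> of degree \<open>2(r + 1)\<close> with leading coefficient a nonzero multiple
    of \<open>(d\<^sub>r)\<^sup>2\<close>. As \<open>M \<noteq> 0\<close> and \<open>d\<^sub>r\<close> is injective, the degree is detected by the module, so that \<open>r = r'\<close>
    (lemma \<open>order_eq\<close>). Comparison of the leading coefficients then yields
    \<open>f\<^sub>q (d\<^sub>r)\<^sup>2 = (d'\<^sub>r)\<^sup>2 f\<^sub>n\<close> for all \<open>q\<close> and \<open>n\<close>. The left side does not contain \<open>n\<close> and \<open>d'\<^sub>r\<close> is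
    injective, so all \<open>f\<^sub>n\<close> are the same map \<open>f\<close> (lemma \<open>component_const\<close>).

  Now \<open>f\<close> intertwines the polynomials \<open>\<Sum>\<^sub>i m\<^bsup>i+1\<^esup>/(i+1)! d\<^sub>i\<close> at every integer \<open>m\<close>, so it intertwines
  their coefficients (lemma \<open>component_E\<close>): it is an isomorphism \<open>M \<cong> M'\<close>. Conversely, given such an
  isomorphism \<open>f\<close> and \<open>\<alpha> = \<alpha>' + k\<close>, the map \<open>v \<otimes> t\<^sup>n \<mapsto> f(v) \<otimes> t\<^bsup>n+k\<^esup>\<close> intertwines the actions.
\<close>

section \<open>Vector-valued polynomials in an integer variable\<close>

locale char_0_vector_space = vector_space scale
  for scale :: "'a::field_char_0 \<Rightarrow> 'b::ab_group_add \<Rightarrow> 'b"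
begin

text \<open>If \<open>p\<close> has degree at most \<open>d + 1\<close> and vanishes on the integers, so does \<open>p(2x) - 2\<^bsup>d+1\<^esup> p(x)\<close>,
  which has degree at most \<open>d\<close> and whose coefficients are nonzero multiples of those of \<open>p\<close>
  in degrees up to \<open>d\<close>. This is an induction on the degree.\<close>

lemma polynomial_zero_imp_coeff_zero:
  assumes "\<And>x::int. (\<Sum>j\<le>d. scale (of_int x ^ j) (a j)) = 0" and "j \<le> d"
  shows "a j = 0"
  using assms
proof (induction d arbitrary: a j)
  case 0
  then show ?case by simp
next
  case (Suc d)
  let ?p = "\<lambda>x::int. \<Sum>j\<le>Suc d. scale (of_int x ^ j) (a j)"
  have "(\<Sum>j\<le>d. scale (of_int x ^ j) (scale (2 ^ j - 2 ^ Suc d) (a j))) = 0" for x :: int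
  proof -
    have "0 = ?p (2 * x) - scale (2 ^ Suc d) (?p x)"
      using Suc.prems(1)[of x] Suc.prems(1)[of "2 * x"] by simp
    also have "\<dots> = (\<Sum>j\<le>Suc d. scale (of_int x ^ j) (scale (2 ^ j - 2 ^ Suc d) (a j)))"
      by (simp only: scale_sum_right sum_subtractf[symmetric])
        (rule sum.cong, auto simp: power_mult_distrib algebra_simps)
    also have "\<dots> = (\<Sum>j\<le>d. scale (of_int x ^ j) (scale (2 ^ j - 2 ^ Suc d) (a j)))"
      by simp
    finally show ?thesis by simp
  qed
  then have lower: "scale (2 ^ i - 2 ^ Suc d) (a i) = 0" if "i \<le> d" for i
    using Suc.IH[of "\<lambda>i. scale (2 ^ i - 2 ^ Suc d) (a i)" i] that by blast
  have zero: "a i = 0" if "i \<le> d" for i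
  proof -
    have "(2 :: 'a) ^ i \<noteq> 2 ^ Suc d"
    proof
      assume "(2 :: 'a) ^ i = 2 ^ Suc d"
      then have "of_nat (2 ^ i) = (of_nat (2 ^ Suc d) :: 'a)" by simp
      then have "(2 :: nat) ^ i = 2 ^ Suc d" by (simp only: of_nat_eq_iff)
      then show False using that by (simp del: power_Suc)
    qed
    then show ?thesis using lower[OF that] by (simp del: power_Suc)
  qed
  have "a (Suc d) = 0"
    using Suc.prems(1)[of 1] zero by simp
  then show ?case using zero Suc.prems(2) by (cases "j = Suc d") auto
qed

lemma polynomial_coeff_unique:
  assumes "\<And>x::int. (\<Sum>j\<le>d. scale (of_int x ^ j) (a j)) = (\<Sum>j\<le>d. scale (of_int x ^ j) (b j))"
    and "j \<le> d"
  shows "a j = b j"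
proof -
  have "a j - b j = 0"
    by (rule polynomial_zero_imp_coeff_zero[where d = d and a = "\<lambda>j. a j - b j"])
      (use assms in \<open>simp_all add: scale_right_diff_distrib sum_subtractf\<close>)
  then show ?thesis by simp
qed

text \<open>\<open>F\<close> is a polynomial of degree at most \<open>d\<close> and \<open>c\<close> is its coefficient in degree \<open>d\<close>, which may be
  \<open>0\<close>. With this convention leading coefficients are additive, and terms of lower order are absorbed
  by raising their degree.\<close>

definition has_lead :: "nat \<Rightarrow> (int \<Rightarrow> 'b) \<Rightarrow> 'b \<Rightarrow> bool" where
  "has_lead d F c \<longleftrightarrow> (\<exists>a. (\<forall>x. F x = (\<Sum>j\<le>d. scale (of_int x ^ j) (a j))) \<and> a d = c)"

lemma has_lead_unique:
  assumes "has_lead d F c" "has_lead d F c'"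
  shows "c = c'"
proof -
  obtain a b where ab: "\<forall>x. F x = (\<Sum>j\<le>d. scale (of_int x ^ j) (a j))" "a d = c"
    "\<forall>x. F x = (\<Sum>j\<le>d. scale (of_int x ^ j) (b j))" "b d = c'"
    using assms unfolding has_lead_def by blast
  have "a d = b d"
  proof (rule polynomial_coeff_unique)
    show "(\<Sum>j\<le>d. scale (of_int x ^ j) (a j)) = (\<Sum>j\<le>d. scale (of_int x ^ j) (b j))" for x :: int
      using ab(1,3) by metis
  qed simp
  then show ?thesis using ab by simp
qed

lemma has_lead_const: "has_lead 0 (\<lambda>_. v) v"
  unfolding has_lead_def by (rule exI[of _ "\<lambda>_. v"]) simp

lemma has_lead_zero: "has_lead d (\<lambda>_. 0) 0"
  unfolding has_lead_def by (rule exI[of _ "\<lambda>_. 0"]) simp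

lemma has_lead_add:
  assumes "has_lead d F c" "has_lead d G c'"
  shows "has_lead d (\<lambda>x. F x + G x) (c + c')"
proof -
  obtain a b where "\<forall>x. F x = (\<Sum>j\<le>d. scale (of_int x ^ j) (a j))" "a d = c"
    "\<forall>x. G x = (\<Sum>j\<le>d. scale (of_int x ^ j) (b j))" "b d = c'"
    using assms unfolding has_lead_def by blast
  then show ?thesis
    unfolding has_lead_def
    by (intro exI[of _ "\<lambda>j. a j + b j"]) (simp add: scale_right_distrib sum.distrib)
qed

lemma has_lead_raise_degree:
  assumes "has_lead d F c" "d < e"
  shows "has_lead e F 0"
proof -
  obtain a where a: "\<forall>x. F x = (\<Sum>j\<le>d. scale (of_int x ^ j) (a j))"
    using assms unfolding has_lead_def by blast
  have "F x = (\<Sum>j\<le>e. scale (of_int x ^ j) (if j \<le> d then a j else 0))" for x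
    unfolding a[rule_format] by (rule sum.mono_neutral_cong_left) (use assms(2) in auto)
  then show ?thesis
    unfolding has_lead_def using assms(2) by (intro exI[of _ "\<lambda>j. if j \<le> d then a j else 0"]) simp
qed

lemma has_lead_times_var:
  assumes "has_lead d F c"
  shows "has_lead (Suc d) (\<lambda>x. scale (of_int x) (F x)) c"
proof -
  obtain a where a: "\<forall>x. F x = (\<Sum>j\<le>d. scale (of_int x ^ j) (a j))" "a d = c"
    using assms unfolding has_lead_def by blast
  have "scale (of_int x) (F x) = (\<Sum>j\<le>Suc d. scale (of_int x ^ j) (case j of 0 \<Rightarrow> 0 | Suc i \<Rightarrow> a i))" for x
    unfolding a(1)[rule_format] by (subst sum.atMost_Suc_shift) (simp add: scale_sum_right)
  then show ?thesis
    unfolding has_lead_def using a(2)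
    by (intro exI[of _ "\<lambda>j. case j of 0 \<Rightarrow> 0 | Suc i \<Rightarrow> a i"]) simp
qed

lemma has_lead_sum:
  assumes "finite I" "\<And>i. i \<in> I \<Longrightarrow> has_lead d (F i) (c i)"
  shows "has_lead d (\<lambda>x. \<Sum>i\<in>I. F i x) (\<Sum>i\<in>I. c i)"
  using assms by (induction I rule: finite_induct) (auto intro: has_lead_zero has_lead_add)

end

lemma has_lead_linear:
  assumes "Vector_Spaces.linear s s' f" "char_0_vector_space.has_lead s d F c"
  shows "char_0_vector_space.has_lead s' d (\<lambda>x. f (F x)) (f c)"
proof -
  interpret f: Vector_Spaces.linear s s' f by fact
  interpret V: char_0_vector_space s by unfold_locales
  interpret W: char_0_vector_space s' by unfold_locales
  obtain a where "\<forall>x. F x = (\<Sum>j\<le>d. s (of_int x ^ j) (a j))" "a d = c"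
    using assms(2) unfolding V.has_lead_def by blast
  then show ?thesis
    unfolding W.has_lead_def by (intro exI[of _ "\<lambda>j. f (a j)"]) (simp add: f.sum f.scale)
qed

context char_0_vector_space
begin

lemma has_lead_scale: "has_lead d F c \<Longrightarrow> has_lead d (\<lambda>x. scale u (F x)) (scale u c)"
  by (rule has_lead_linear) (rule linear_scale_self)

lemma has_lead_affine_power:
  assumes "has_lead d F c"
  shows "has_lead (d + i) (\<lambda>x. scale ((u + b * of_int x) ^ i) (F x)) (scale (b ^ i) c)"
proof (induction i)
  case 0
  then show ?case using assms by simp
next
  case (Suc i)
  let ?G = "\<lambda>x. scale ((u + b * of_int x) ^ i) (F x)"
  have "has_lead (Suc (d + i)) (\<lambda>x. scale u (?G x) + scale b (scale (of_int x) (?G x)))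
      (0 + scale b (scale (b ^ i) c))"
    by (intro has_lead_add has_lead_scale has_lead_times_var has_lead_raise_degree[OF has_lead_scale])
      (use Suc in auto)
  then show ?case by (simp add: algebra_simps)
qed

end


section \<open>Weights and leading coefficients in \<open>\<N>(M, \<alpha>)\<close>\<close>

sublocale vir_quot_module \<subseteq> char_0_vector_space s
  by unfold_locales

context vir_quot_module
begin

text \<open>At \<open>m = 0\<close> all terms \<open>m\<^bsup>i+1\<^esup> d\<^sub>i\<close> vanish, so the action of \<open>d\<^sub>0\<close> on the degree \<open>j\<close> component is
  multiplication by \<open>\<alpha> + j\<close>.\<close>

lemma weight_vector_lookup:
  assumes "N (vir_d 0) w = pm_scale s \<beta> w" "Poly_Mapping.lookup w j \<noteq> 0"
  shows "\<beta> = \<alpha> + of_int j"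
proof -
  have "s (\<alpha> + of_int j) (Poly_Mapping.lookup w j) = s \<beta> (Poly_Mapping.lookup w j)"
    using arg_cong[OF assms(1), of "\<lambda>w. Poly_Mapping.lookup w j"]
    by (simp add: vir_d_e N_basis lookup_A T_eq X_def del: loop_basis_act.simps(1))
  then show ?thesis using assms(2) by simp
qed

lemma N_d_0_single: "N (vir_d 0) (Poly_Mapping.single n v) = pm_scale s (\<alpha> + of_int n) (Poly_Mapping.single n v)"
  by (simp add: N_single T_eq X_def pm_scale_single)

lemma weight_vector_single:
  assumes "N (vir_d 0) w = pm_scale s (\<alpha> + of_int n) w"
  shows "w = Poly_Mapping.single n (Poly_Mapping.lookup w n)"
proof (rule poly_mapping_eqI)
  fix j
  show "Poly_Mapping.lookup w j = Poly_Mapping.lookup (Poly_Mapping.single n (Poly_Mapping.lookup w n)) j"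
    using weight_vector_lookup[OF assms, of j] by (auto simp: lookup_single when_def)
qed

lemma X_as_polynomial:
  "X m v = (\<Sum>j\<le>Suc r. s (m ^ j) (case j of 0 \<Rightarrow> 0 | Suc i \<Rightarrow> s (1 / fact (Suc i)) (E i v)))"
  unfolding X_def by (subst sum.atMost_Suc_shift) simp

lemma has_lead_X_affine:
  assumes "has_lead d F c"
  shows "has_lead (d + Suc r) (\<lambda>x. X (u + b * of_int x) (F x)) (s (b ^ Suc r / fact (Suc r)) (E r c))"
proof -
  let ?G = "\<lambda>i x. s ((u + b * of_int x) ^ Suc i / fact (Suc i)) (E i (F x))"
  have G: "has_lead (d + Suc i) (?G i) (s (b ^ Suc i / fact (Suc i)) (E i c))" for i
    using has_lead_scale[OF has_lead_affine_power[where i = "Suc i", OF has_lead_linear[OF E_linear assms]],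
        of "1 / fact (Suc i)" u b i]
    by simp
  have "has_lead (d + Suc r) (\<lambda>x. (\<Sum>i<r. ?G i x) + ?G r x)
      ((\<Sum>i<r. 0) + s (b ^ Suc r / fact (Suc r)) (E r c))"
    by (intro has_lead_add has_lead_sum G has_lead_raise_degree[OF G]) auto
  then show ?thesis by (simp add: X_def lessThan_Suc_atMost[symmetric])
qed

text \<open>Each of the two factors contributes \<open>\<plusminus>x\<^bsup>r+1\<^esup>/(r+1)! d\<^sub>r\<close> to the highest order. The assumption on
  \<open>r\<close> matters: in the left factor the scalar \<open>\<alpha> + n + x\<close> also grows with \<open>x\<close>, and only for \<open>r \<ge> 1\<close> is it
  of lower order than \<open>x\<^bsup>r+1\<^esup>\<close>.\<close>

lemma has_lead_T_T:
  assumes "r \<ge> 1"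
  shows "has_lead (2 * Suc r) (\<lambda>x. T (t - x) (n + x) (T x n v))
    (s ((-1) ^ Suc r / (fact (Suc r))\<^sup>2) (E r (E r v)))"
proof -
  have "has_lead (0 + Suc r) (\<lambda>x. s (\<alpha> + of_int n) v + X (0 + 1 * of_int x) v)
      (0 + s (1 ^ Suc r / fact (Suc r)) (E r v))"
    by (intro has_lead_add has_lead_X_affine has_lead_const has_lead_raise_degree[OF has_lead_const]) simp
  then have T1: "has_lead (Suc r) (\<lambda>x. T x n v) (s (1 / fact (Suc r)) (E r v))"
    by (simp add: T_eq)
  have "has_lead (Suc r + Suc r) (\<lambda>x. s ((\<alpha> + of_int n + 1 * of_int x) ^ 1) (T x n v)
        + X (of_int t + (- 1) * of_int x) (T x n v))
      (0 + s ((-1) ^ Suc r / fact (Suc r)) (E r (s (1 / fact (Suc r)) (E r v))))"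
    by (intro has_lead_add has_lead_X_affine T1 has_lead_raise_degree[OF has_lead_affine_power[OF T1]])
      (use assms in simp)
  then show ?thesis
    unfolding mult_2 by (simp add: T_eq[of "_ - _"] E_simps power2_eq_square algebra_simps)
qed

end


section \<open>Injective homomorphisms between the modules \<open>\<N>(M, \<alpha>)\<close>\<close>

locale loop_embedding =
  V: vir_quot_module r s \<rho> \<alpha> + W: vir_quot_module r' s' \<rho>' \<alpha>'
  for r and s :: "complex \<Rightarrow> 'v::ab_group_add \<Rightarrow> 'v" and \<rho> \<alpha>
    and r' and s' :: "complex \<Rightarrow> 'w::ab_group_add \<Rightarrow> 'w" and \<rho>' \<alpha>' +
  fixes \<phi> :: "(int \<Rightarrow>\<^sub>0 'v) \<Rightarrow> (int \<Rightarrow>\<^sub>0 'w)"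
  assumes \<phi>_linear: "Vector_Spaces.linear (pm_scale s) (pm_scale s') \<phi>"
    and \<phi>_inj: "inj \<phi>"
    and \<phi>_hom: "\<phi> (V.N x w) = W.N x (\<phi> w)"
begin

sublocale \<phi>: Vector_Spaces.linear "pm_scale s" "pm_scale s'" \<phi>
  by (rule \<phi>_linear)

lemma \<phi>_eq_0_iff: "\<phi> w = 0 \<longleftrightarrow> w = 0"
  using \<phi>_inj \<phi>.zero by (metis injD)

lemma \<phi>_weight: "W.N (vir_d 0) (\<phi> (Poly_Mapping.single n v)) =
    pm_scale s' (\<alpha> + of_int n) (\<phi> (Poly_Mapping.single n v))"
  by (simp add: \<phi>_hom[symmetric] V.N_d_0_single \<phi>.scale)

lemma shift_exists:
  assumes "(UNIV :: 'v set) \<noteq> {0}"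
  shows "\<exists>k::int. \<alpha> - \<alpha>' = of_int k"
proof -
  obtain v :: 'v where "v \<noteq> 0" using assms by blast
  then have "Poly_Mapping.single 0 v \<noteq> (0 :: int \<Rightarrow>\<^sub>0 'v)"
    by (metis lookup_single_eq lookup_zero)
  then obtain j where "Poly_Mapping.lookup (\<phi> (Poly_Mapping.single 0 v)) j \<noteq> 0"
    using \<phi>_eq_0_iff by (metis poly_mapping_eqI lookup_zero)
  from W.weight_vector_lookup[OF \<phi>_weight this] show ?thesis
    by (intro exI[of _ j]) (simp add: algebra_simps)
qed

end

locale shifted_loop_embedding = loop_embedding r s \<rho> \<alpha> r' s' \<rho>' \<alpha>' \<phi>
  for r and s :: "complex \<Rightarrow> 'v::ab_group_add \<Rightarrow> 'v" and \<rho> \<alpha>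
    and r' and s' :: "complex \<Rightarrow> 'w::ab_group_add \<Rightarrow> 'w" and \<rho>' \<alpha>' \<phi> +
  fixes k :: int
  assumes shift: "\<alpha> = \<alpha>' + of_int k"
begin

definition component where
  "component n v = Poly_Mapping.lookup (\<phi> (Poly_Mapping.single n v)) (n + k)"

lemma \<phi>_single: "\<phi> (Poly_Mapping.single n v) = Poly_Mapping.single (n + k) (component n v)"
  unfolding component_def
  by (rule W.weight_vector_single) (simp add: \<phi>_weight shift algebra_simps)

lemma component_linear: "Vector_Spaces.linear s s' (component n)"
proof -
  have "component n (s a v) = s' a (component n v)" for a v
    unfolding component_def by (simp add: pm_scale_single[symmetric] \<phi>.scale)
  moreover have "component n (v + w) = component n v + component n w" for v w
    unfolding component_def by (simp add: single_add \<phi>.add lookup_add)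
  ultimately show ?thesis
    by (simp add: Vector_Spaces.linear_def module_hom_def module_hom_axioms_def
        V.vector_space_axioms W.vector_space_axioms V.module_axioms W.module_axioms)
qed

lemma component_zero: "component n 0 = 0"
  by (simp add: component_def \<phi>.zero)

lemma component_inj: "inj (component n)"
proof (rule injI)
  fix v w assume "component n v = component n w"
  then have "\<phi> (Poly_Mapping.single n v) = \<phi> (Poly_Mapping.single n w)" by (simp add: \<phi>_single)
  then show "v = w" using \<phi>_inj by (metis injD lookup_single_eq)
qed

text \<open>A preimage under \<open>\<phi>\<close> of a vector of degree \<open>n + k\<close> has the same weight, since \<open>\<phi>\<close> is
  injective, and is therefore concentrated in degree \<open>n\<close>.\<close>

lemma component_surj:
  assumes "surj \<phi>"
  shows "surj (component n)"
proof (unfold surj_def, rule allI)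
  fix w
  obtain u where u: "\<phi> u = Poly_Mapping.single (n + k) w" using assms by (metis surjD)
  have "\<phi> (V.N (vir_d 0) u) = \<phi> (pm_scale s (\<alpha> + of_int n) u)"
    unfolding \<phi>_hom \<phi>.scale u W.N_d_0_single by (simp add: shift algebra_simps)
  then have "u = Poly_Mapping.single n (Poly_Mapping.lookup u n)"
    using \<phi>_inj by (intro V.weight_vector_single) (metis injD)
  then have "Poly_Mapping.single (n + k) (component n (Poly_Mapping.lookup u n)) = Poly_Mapping.single (n + k) w"
    using \<phi>_single u by metis
  then show "\<exists>v. w = component n v" by (metis lookup_single_eq)
qed

lemma component_T: "component (n + m) (V.T m n v) = W.T m (n + k) (component n v)"
proof -
  have "Poly_Mapping.single (n + m + k) (component (n + m) (V.T m n v))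
      = Poly_Mapping.single (n + k + m) (W.T m (n + k) (component n v))"
    by (simp add: \<phi>_single[symmetric] V.N_single[symmetric] W.N_single[symmetric] \<phi>_hom)
  moreover have "n + m + k = n + k + m" by simp
  ultimately show ?thesis
    using lookup_single_eq by metis
qed

text \<open>Moving the two-step operators across \<open>\<phi>\<close>: as \<open>x\<close> varies, the path from degree \<open>n\<close> via \<open>n + x\<close> keeps
  its end points, so the same two components intertwine the polynomials for all \<open>x\<close>.\<close>

lemma component_has_lead:
  assumes "V.has_lead d (\<lambda>x. V.T (q - n - x) (n + x) (V.T x n v)) c"
  shows "W.has_lead d (\<lambda>x. W.T (q - n - x) (n + k + x) (W.T x (n + k) (component n v))) (component q c)"
proof -
  have "component q (V.T (q - n - x) (n + x) (V.T x n v))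
      = W.T (q - n - x) (n + k + x) (W.T x (n + k) (component n v))" for x
  proof -
    have "n + x + (q - n - x) = q" "n + x + k = n + k + x" by simp_all
    then show ?thesis
      using component_T[of "n + x" "q - n - x" "V.T x n v"] component_T[of n x v] by (simp only:)
  qed
  then show ?thesis using has_lead_linear[OF component_linear assms, of q] by simp
qed

text \<open>Both sides of the intertwining relation are the same polynomial. If the orders differed, its
  coefficient in the degree belonging to the larger order would be zero according to the module of
  smaller order, but nonzero by injectivity according to the other one.\<close>

lemma order_eq:
  assumes "r \<ge> 1" "r' \<ge> 1" "inj (V.E r)" "inj (W.E r')" "(UNIV :: 'v set) \<noteq> {0}"
  shows "r = r'"
proof -
  obtain v :: 'v where v: "v \<noteq> 0" using assms by blast
  have E0: "V.E r u = 0 \<longleftrightarrow> u = 0" for u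
    using assms(3) V.E_simps(3) by (metis injD)
  have E0': "W.E r' u = 0 \<longleftrightarrow> u = 0" for u
    using assms(4) W.E_simps(3) by (metis injD)
  have f0: "component n u = 0 \<longleftrightarrow> u = 0" for n u
    using component_inj[of n] component_zero[of n] by (metis injD)
  \<comment> \<open>It is enough to compare the paths from degree \<open>0\<close> back to degree \<open>0\<close>; the index \<open>0 - 0\<close> matches
    \<open>q - n\<close> in the transported polynomial.\<close>
  note L = component_has_lead[OF V.has_lead_T_T[OF assms(1), of "0 - 0" 0 v]]
  note L' = W.has_lead_T_T[OF assms(2), of "0 - 0" "0 + k" "component 0 v"]
  have "\<not> r' < r"
  proof
    assume "r' < r"
    then have "component 0 (s ((-1) ^ Suc r / (fact (Suc r))\<^sup>2) (V.E r (V.E r v))) = 0"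
      by (intro W.has_lead_unique[OF L W.has_lead_raise_degree[OF L']]) simp
    then show False using v by (simp add: f0 E0 del: fact_Suc)
  qed
  moreover have "\<not> r < r'"
  proof
    assume "r < r'"
    then have "W.has_lead (2 * Suc r') (\<lambda>x. W.T (0 - 0 - x) (0 + k + x) (W.T x (0 + k) (component 0 v))) 0"
      by (intro W.has_lead_raise_degree[OF L]) simp
    from W.has_lead_unique[OF L' this] show False
      using v by (simp add: f0 E0' del: fact_Suc)
  qed
  ultimately show ?thesis by simp
qed

text \<open>Leading coefficients of the paths from degree \<open>n\<close> to degree \<open>0\<close>: only the right side of the
  equation below depends on \<open>n\<close>, and \<open>d'\<^sub>r\<close> can be cancelled from it.\<close>

lemma component_const:
  assumes "r \<ge> 1" "r = r'" "inj (W.E r')"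
  shows "component n v = component m v"
proof -
  let ?c = "(-1) ^ Suc r / (fact (Suc r))\<^sup>2 :: complex"
  have *: "component 0 (s ?c (V.E r (V.E r v))) = s' ?c (W.E r' (W.E r' (component n v)))" for n
    using W.has_lead_unique[OF component_has_lead[OF V.has_lead_T_T[OF assms(1)], of 0 n v]]
      W.has_lead_T_T[of "0 - n" "n + k" "component n v"] assms(1,2) by simp
  have "?c \<noteq> 0" by (simp del: fact_Suc)
  then have "W.E r' (W.E r' (component n v)) = W.E r' (W.E r' (component m v))"
    using *[of n] *[of m] W.scale_left_imp_eq by metis
  then show ?thesis using assms(3) by (metis injD)
qed

text \<open>With a single map in all degrees, the intertwining relation for \<open>d\<^sub>m\<close> becomes an identity of
  polynomials in \<open>m\<close>, whose coefficients are the actions of the generators.\<close>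

lemma component_E:
  assumes "r \<ge> 1" "r = r'" "inj (W.E r')"
  shows "component 0 (V.E i v) = W.E i (component 0 v)"
proof (cases "i \<le> r")
  case True
  interpret f: Vector_Spaces.linear s s' "component 0" by (rule component_linear)
  have X: "component 0 (V.X (of_int m) v) = W.X (of_int m) (component 0 v)" for m
    using component_T[of 0 m v] component_const[OF assms, of m _ 0]
    unfolding V.T_eq W.T_eq by (simp add: f.add f.scale shift)
  \<comment> \<open>The coefficient of \<open>m\<^bsup>i+1\<^esup>\<close> belongs to the generator with index \<open>i\<close>; the constant term is \<open>0\<close>.\<close>
  define a where "a j = (case j of 0 \<Rightarrow> 0 | Suc i \<Rightarrow> s' (1 / fact (Suc i)) (component 0 (V.E i v)))" for j
  define b where "b j = (case j of 0 \<Rightarrow> 0 | Suc i \<Rightarrow> s' (1 / fact (Suc i)) (W.E i (component 0 v)))" for j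
  have a: "component 0 (V.X m v) = (\<Sum>j\<le>Suc r. s' (m ^ j) (a j))" for m
    unfolding V.X_as_polynomial f.sum a_def
  proof (rule sum.cong)
    fix j
    show "component 0 (s (m ^ j) (case j of 0 \<Rightarrow> 0 | Suc i \<Rightarrow> s (1 / fact (Suc i)) (V.E i v)))
        = s' (m ^ j) (case j of 0 \<Rightarrow> 0 | Suc i \<Rightarrow> s' (1 / fact (Suc i)) (component 0 (V.E i v)))"
      by (cases j) (simp_all only: f.scale f.zero nat.case)
  qed simp
  have b: "W.X m (component 0 v) = (\<Sum>j\<le>Suc r. s' (m ^ j) (b j))" for m
    unfolding W.X_as_polynomial b_def assms(2) ..
  have "(\<Sum>j\<le>Suc r. s' (of_int m ^ j) (a j)) = (\<Sum>j\<le>Suc r. s' (of_int m ^ j) (b j))" for m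
    using X[of m] unfolding a b .
  then have "a (Suc i) = b (Suc i)"
    by (rule W.polynomial_coeff_unique) (use True in simp)
  then show ?thesis by (simp add: a_def b_def del: fact_Suc)
next
  case False
  then show ?thesis
    using V.E_zero[of i v] W.E_zero[of i "component 0 v"] component_zero[of 0] assms(2) by simp
qed

end


section \<open>Homomorphisms of modules over the quotient algebras\<close>

text \<open>The quotient algebra is spanned by the cosets of the \<open>d\<^sub>i\<close>. The span is taken upstairs, in the
  algebra of the representatives, because that one lives on a type with vector space operations.\<close>

lemma vir_quot_hom_if_dbar_hom:
  assumes "lie_module (vir_quot r) s \<rho>" "lie_module (vir_quot r) s' \<rho>'"
    and "Vector_Spaces.linear s s' f"
    and dbar: "\<And>i v. f (\<rho> (dbar r i) v) = \<rho>' (dbar r i) (f v)"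
    and "x \<in> lie_carrier (vir_quot r)"
  shows "f (\<rho> x v) = \<rho>' x (f v)"
proof -
  interpret V: lie_module "vir_quot r" s \<rho> by fact
  interpret W: lie_module "vir_quot r" s' \<rho>' by fact
  interpret f: Vector_Spaces.linear s s' f by fact
  let ?q = "lie_coset vir_plus (vir_plus_ideal r)"
  let ?S = "{y \<in> vir_supp (- 1). \<forall>v. f (\<rho> (?q y) v) = \<rho>' (?q y) (f v)}"
  have carrier: "?q y \<in> lie_carrier (vir_quot r)" if "y \<in> vir_supp (- 1)" for y
    using that by (simp add: vir_quot_def lie_quotient_def)
  have add: "?q (y + z) = lie_add (vir_quot r) (?q y) (?q z)"
    if "y \<in> vir_supp (- 1)" "z \<in> vir_supp (- 1)" for y z
    using vir_ideal.coset_add[of y z r] that by (simp add: vir_quot_def)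
  have scale: "?q (vir_scale a y) = lie_scale (vir_quot r) a (?q y)" if "y \<in> vir_supp (- 1)" for a y
    using vir_ideal.coset_scale[of y r a] that by (simp add: vir_quot_def)
  note subspace = subspace_vir_supp[of "- 1"]
  have "vir.subspace ?S"
  proof (rule vir.subspaceI)
    have "?q 0 = lie_scale (vir_quot r) 0 (?q 0)"
      using scale[of 0 0] vir.subspace_0[OF subspace] by simp
    then show "0 \<in> ?S"
      using V.act_scale[OF carrier, of 0 0] W.act_scale[OF carrier, of 0 0] vir.subspace_0[OF subspace]
      by (auto simp: f.zero)
  qed (use vir.subspace_add[OF subspace] vir.subspace_scale[OF subspace] in
      \<open>auto simp: add scale V.act_add V.act_scale W.act_add W.act_scale carrier f.add f.scale\<close>)
  moreover have "{vir_d i | i. i > - 1} \<subseteq> ?S"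
  proof
    fix y assume "y \<in> {vir_d i | i. i > - 1}"
    then obtain i where i: "y = vir_d i" "i > - 1" by blast
    then have "?q y = dbar r (nat i)" by (simp add: dbar_def)
    then show "y \<in> ?S" using dbar[of "nat i"] vir_supp_d[OF i(2)] i(1) by simp
  qed
  ultimately have "vir_supp (- 1) \<subseteq> ?S"
    unfolding vir_supp_span by (intro vir.span_minimal)
  moreover obtain y where "x = ?q y" "y \<in> vir_supp (- 1)"
    using assms(5) by (auto simp: vir_quot_def lie_quotient_def)
  ultimately show ?thesis by blast
qed


section \<open>Shifting the degree\<close>

text \<open>The map \<open>v \<otimes> t\<^sup>n \<mapsto> f(v) \<otimes> t\<^bsup>n+k\<^esup>\<close>. It is a finitely supported function only if \<open>f 0 = 0\<close>.\<close>

definition loop_shift :: "int \<Rightarrow> ('v::zero \<Rightarrow> 'w::zero) \<Rightarrow> (int \<Rightarrow>\<^sub>0 'v) \<Rightarrow> (int \<Rightarrow>\<^sub>0 'w)" where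
  "loop_shift k f w = Abs_poly_mapping (\<lambda>n. f (Poly_Mapping.lookup w (n - k)))"

lemma lookup_loop_shift:
  assumes "f 0 = 0"
  shows "Poly_Mapping.lookup (loop_shift k f w) n = f (Poly_Mapping.lookup w (n - k))"
proof -
  have "{n. f (Poly_Mapping.lookup w (n - k)) \<noteq> 0} \<subseteq> (\<lambda>n. n + k) ` Poly_Mapping.keys w"
  proof
    fix n assume "n \<in> {n. f (Poly_Mapping.lookup w (n - k)) \<noteq> 0}"
    then have "n - k \<in> Poly_Mapping.keys w" using assms by (auto simp: in_keys_iff)
    then show "n \<in> (\<lambda>n. n + k) ` Poly_Mapping.keys w" by (rule rev_image_eqI) simp
  qed
  then have "finite {n. f (Poly_Mapping.lookup w (n - k)) \<noteq> 0}"
    by (rule finite_subset) simp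
  then show ?thesis by (simp add: loop_shift_def)
qed

lemma bij_loop_shift:
  assumes "bij f" "f 0 = 0"
  shows "bij (loop_shift k f)"
proof (rule o_bij)
  have inv0: "inv f 0 = 0" using assms by (metis bij_inv_eq_iff)
  show "loop_shift (- k) (inv f) \<circ> loop_shift k f = id"
    by (intro ext poly_mapping_eqI)
      (simp add: lookup_loop_shift assms(2) inv0 inv_f_f bij_is_inj[OF assms(1)])
  show "loop_shift k f \<circ> loop_shift (- k) (inv f) = id"
    by (intro ext poly_mapping_eqI)
      (simp add: lookup_loop_shift assms(2) inv0 surj_f_inv_f bij_is_surj[OF assms(1)])
qed

lemma loop_iso_if_iso:
  assumes "vir_quot_module r s \<rho>" "vir_quot_module r s' \<rho>'"
    and shift: "\<alpha> = \<alpha>' + of_int k"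
    and iso: "lie_module_iso (vir_quot r) s \<rho> s' \<rho>'"
  shows "lie_module_iso virasoro (pm_scale s) (loop_act r s \<rho> \<alpha>) (pm_scale s') (loop_act r s' \<rho>' \<alpha>')"
proof -
  interpret V: vir_quot_module r s \<rho> \<alpha> by fact
  interpret W: vir_quot_module r s' \<rho>' \<alpha>' by fact
  obtain f where f: "Vector_Spaces.linear s s' f" "bij f"
    and hom: "\<And>i v. f (V.E i v) = W.E i (f v)"
    using iso dbar_carrier unfolding lie_module_iso_def by blast
  interpret f: Vector_Spaces.linear s s' f by (rule f)
  let ?\<phi> = "loop_shift k f"
  note lookup = lookup_loop_shift[of f, OF f.zero]
  have T: "f (V.T m n v) = W.T m (n + k) (f v)" for m n v
    unfolding V.T_eq W.T_eq V.X_def W.X_def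
    by (simp add: f.add f.scale f.sum hom shift algebra_simps)
  have linear: "Vector_Spaces.linear (pm_scale s) (pm_scale s') ?\<phi>"
    by (auto simp: Vector_Spaces.linear_def module_hom_def module_hom_axioms_def
        V.loop.vector_space_axioms W.loop.vector_space_axioms V.loop.module_axioms
        W.loop.module_axioms lookup lookup_add f.add f.scale intro!: poly_mapping_eqI)
  interpret \<phi>: Vector_Spaces.linear "pm_scale s" "pm_scale s'" ?\<phi> by (rule linear)
  have basis: "?\<phi> (V.A b w) = W.A b (?\<phi> w)" for b w
  proof (cases b)
    case (Vir_d m)
    show ?thesis
      unfolding Vir_d
      by (rule poly_mapping_eqI)
        (simp add: lookup V.lookup_A W.lookup_A T del: loop_basis_act.simps(1), simp add: algebra_simps)
  qed (simp add: \<phi>.zero)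
  have "?\<phi> (V.N x w) = W.N x (?\<phi> w)" for x w
    by (simp add: loop_act_def lin_ext_def \<phi>.sum \<phi>.scale basis)
  then show ?thesis
    unfolding lie_module_iso_def using linear bij_loop_shift[OF f(2) f.zero] by blast
qed

theorem theorem5:
  fixes s :: "complex \<Rightarrow> 'v::ab_group_add \<Rightarrow> 'v" and \<rho> :: "vir set \<Rightarrow> 'v \<Rightarrow> 'v"
    and s' :: "complex \<Rightarrow> 'w::ab_group_add \<Rightarrow> 'w" and \<rho>' :: "vir set \<Rightarrow> 'w \<Rightarrow> 'w"
    and \<alpha> \<alpha>' :: complex and r r' :: nat
  assumes "r \<ge> 1" and "r' \<ge> 1"
    and "simple_lie_module (vir_quot r) s \<rho>"
    and "simple_lie_module (vir_quot r') s' \<rho>'"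
    and "inj (\<rho> (dbar r r))"
    and "inj (\<rho>' (dbar r' r'))"
  shows "lie_module_iso virasoro (pm_scale s) (loop_act r s \<rho> \<alpha>) (pm_scale s') (loop_act r' s' \<rho>' \<alpha>')
    \<longleftrightarrow> \<alpha> - \<alpha>' \<in> \<int> \<and> r = r' \<and> lie_module_iso (vir_quot r) s \<rho> s' \<rho>'"
proof
  have M: "lie_module (vir_quot r) s \<rho>" "lie_module (vir_quot r') s' \<rho>'" "(UNIV :: 'v set) \<noteq> {0}"
    using assms(3,4) by (auto simp: simple_lie_module_def)
  then have V: "vir_quot_module r s \<rho>" and W: "vir_quot_module r' s' \<rho>'"
    by (simp_all add: vir_quot_module_def)
  {
    assume "\<alpha> - \<alpha>' \<in> \<int> \<and> r = r' \<and> lie_module_iso (vir_quot r) s \<rho> s' \<rho>'"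
    moreover from this obtain k where "\<alpha> - \<alpha>' = of_int k" by (auto elim: Ints_cases)
    then have "\<alpha> = \<alpha>' + of_int k" by (simp add: algebra_simps)
    ultimately show "lie_module_iso virasoro (pm_scale s) (loop_act r s \<rho> \<alpha>)
        (pm_scale s') (loop_act r' s' \<rho>' \<alpha>')"
      using loop_iso_if_iso V W by blast
  }
  assume "lie_module_iso virasoro (pm_scale s) (loop_act r s \<rho> \<alpha>) (pm_scale s') (loop_act r' s' \<rho>' \<alpha>')"
  then obtain \<phi> where \<phi>: "Vector_Spaces.linear (pm_scale s) (pm_scale s') \<phi>" "bij \<phi>"
    "\<And>x w. \<phi> (loop_act r s \<rho> \<alpha> x w) = loop_act r' s' \<rho>' \<alpha>' x (\<phi> w)"
    unfolding lie_module_iso_def by (auto simp: virasoro_def)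
  have emb: "loop_embedding r s \<rho> \<alpha> r' s' \<rho>' \<alpha>' \<phi>"
    using V W \<phi> by (simp add: loop_embedding_def loop_embedding_axioms_def bij_is_inj)
  then obtain k where k: "\<alpha> - \<alpha>' = of_int k"
    using loop_embedding.shift_exists M(3) by blast
  interpret shifted_loop_embedding r s \<rho> \<alpha> r' s' \<rho>' \<alpha>' \<phi> k
    using emb k
    by (simp add: shifted_loop_embedding_def shifted_loop_embedding_axioms_def algebra_simps)
  have r: "r = r'" using order_eq assms M(3) by blast
  have "bij (component 0)"
    using component_inj component_surj[OF bij_is_surj[OF \<phi>(2)]] by (simp add: bij_def)
  moreover have "component 0 (\<rho> x v) = \<rho>' x (component 0 v)" if "x \<in> lie_carrier (vir_quot r)" for x v
    using vir_quot_hom_if_dbar_hom[OF M(1) M(2)[folded r] component_linear _ that]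
      component_E[OF assms(1) r assms(6)] r by metis
  ultimately have "lie_module_iso (vir_quot r) s \<rho> s' \<rho>'"
    unfolding lie_module_iso_def using component_linear by blast
  then show "\<alpha> - \<alpha>' \<in> \<int> \<and> r = r' \<and> lie_module_iso (vir_quot r) s \<rho> s' \<rho>'"
    using r k by simp
qed

end
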